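(* Let $\theta^\star\in\mathbb{R}^n$ be deterministic with $|\theta^\star_i|\le\mu$ for all $i\in[n]$, where $\mu\ge1$. Let $\pi$ be a uniformly random permutation of $[n]$, $\theta=(\theta^\star_{\pi(1)},\dots,\theta^\star_{\pi(n)})$, and conditionally on $\theta$ let $X\sim\mathcal N(\theta,I_n)$. Define $\widehat\theta^{\rm S}_i=\mathbb{E}[\theta_i\mid X_i]$ and $\widehat\theta^{\rm PI}_i=\mathbb{E}[\theta_i\mid X]$. Then $$\mathbb{E}\big[\|\widehat\theta^{\rm S}-\widehat\theta^{\rm PI}\|_2^2\big]\le\min\{C\mu\log^2 n,\;n\},$$ where $C<\infty$ is an absolute constant. *)

theory Defs
  imports "HOL-Probability.Probability" "HOL-Combinatorics.Permutations"
begin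

text \<open>Sample space: a pair (p, z) of a permutation p of {..<n} (uniformly distributed)
  and an independent standard Gaussian noise vector z indexed by {..<n}.
  Coordinates are indexed by {..<n} (0-based) instead of [n] = {1..n}.\<close>

definition perm_gauss_space :: "nat \<Rightarrow> ((nat \<Rightarrow> nat) \<times> (nat \<Rightarrow> real)) measure" where
  "perm_gauss_space n =
     measure_pmf (pmf_of_set {p. p permutes {..<n}})
       \<Otimes>\<^sub>M (\<Pi>\<^sub>M i\<in>{..<n}. density lborel std_normal_density)"

definition theta_rv :: "(nat \<Rightarrow> real) \<Rightarrow> nat \<Rightarrow> (nat \<Rightarrow> nat) \<times> (nat \<Rightarrow> real) \<Rightarrow> real" where
  "theta_rv ts i \<omega> = ts (fst \<omega> i)"

text \<open>The observation X = theta + Z, so that X | theta ~ N(theta, I_n).\<close>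
definition obs_rv :: "(nat \<Rightarrow> real) \<Rightarrow> nat \<Rightarrow> (nat \<Rightarrow> nat) \<times> (nat \<Rightarrow> real) \<Rightarrow> real" where
  "obs_rv ts i \<omega> = ts (fst \<omega> i) + snd \<omega> i"

definition sep_est :: "nat \<Rightarrow> (nat \<Rightarrow> real) \<Rightarrow> nat \<Rightarrow> (nat \<Rightarrow> nat) \<times> (nat \<Rightarrow> real) \<Rightarrow> real" where
  "sep_est n ts i =
     real_cond_exp (perm_gauss_space n)
       (vimage_algebra (space (perm_gauss_space n)) (obs_rv ts i) borel)
       (theta_rv ts i)"

definition pi_est :: "nat \<Rightarrow> (nat \<Rightarrow> real) \<Rightarrow> nat \<Rightarrow> (nat \<Rightarrow> nat) \<times> (nat \<Rightarrow> real) \<Rightarrow> real" where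
  "pi_est n ts i =
     real_cond_exp (perm_gauss_space n)
       (vimage_algebra (space (perm_gauss_space n))
          (\<lambda>\<omega>. restrict (\<lambda>j. obs_rv ts j \<omega>) {..<n}) (\<Pi>\<^sub>M j\<in>{..<n}. borel))
       (theta_rv ts i)"

end

theory Submission
  imports Defs
begin

text \<open>
  For every separable rule \<open>h\<close> the gap is at most \<open>D = \<Sum>\<^sub>i E f\<^sub>i(X)\<^sup>2\<close> with
  \<open>f\<^sub>i(X) = E[\<theta>\<^sub>i | X] - h(X\<^sub>i)\<close>, by Pythagoras, and \<open>D = E \<Sum>\<^sub>i (\<theta>\<^sub>i - h(X\<^sub>i)) f\<^sub>i(X)\<close>.
  Expand \<open>\<theta>\<^sub>i\<close> into its coarse grid value, clipped to a window of radius \<open>r + 1\<close> around \<open>X\<^sub>i\<close>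
  with \<open>r = \<surd>(2 ln n)\<close>, plus dyadic increments, plus a negligible remainder, and let \<open>h\<close> be the
  sum of the posterior means of the terms when the \<open>\<theta>\<^sub>i\<close> are i.i.d. from the empirical distribution.

  A term \<open>g\<close> that depends on the label only through one of \<open>K\<close> classes of diameter at most 1, and
  whose values for fixed \<open>x\<close> lie in an interval of length \<open>R\<close>, is handled by a change of
  measure. Under the i.i.d. prior \<open>\<Sum>\<^sub>i (g - E[g | X\<^sub>i]) f\<^sub>i(X)\<close> is conditionally sub-Gaussian by
  Hoeffding's lemma, and the relative entropy of (classes, observations) under the permutation prior
  with respect to the i.i.d. prior is at most \<open>3 K (1 + ln n) + 2\<close>: reveal the labels one by one,
  and bound the entropy of each step by the chi-square divergence of sampling without
  replacement. So the term contributes at most \<open>a D + R\<^sup>2 (3 K (1 + ln n) + 2) / (8 a)\<close> for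
  every \<open>a > 0\<close>. The coarse scale has \<open>R \<le> 2 (r + 1)\<close>, \<open>K \<le> 4 \<mu>\<close>, and increment \<open>j\<close> has
  \<open>R = 2\<^sup>-\<^sup>j\<close>, \<open>K \<le> 8 \<mu> 2\<^sup>j\<close>, so the contributions sum geometrically to \<open>O(\<mu> ln\<^sup>2 n)\<close>.
\<close>

subsection \<open>Finite sums over labels and permutations\<close>

lemma hoeffding_weighted_mean_pos:
  fixes w g :: "'a \<Rightarrow> real"
  assumes fin: "finite A" and w: "\<And>k. k \<in> A \<Longrightarrow> 0 \<le> w k" and W: "0 < sum w A"
    and g: "\<And>k. k \<in> A \<Longrightarrow> lo \<le> g k \<and> g k \<le> lo + R" and t: "0 < t"
  shows "(\<Sum>k\<in>A. w k * exp (t * (g k - (\<Sum>k\<in>A. w k * g k) / sum w A)))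
           \<le> sum w A * exp (t\<^sup>2 * R\<^sup>2 / 8)"
proof -
  define W where "W = sum w A"
  define N where "N = point_measure A (\<lambda>k. ennreal (w k / W))"
  have Wp: "W > 0" using W by (simp add: W_def)
  have wW: "\<And>k. k \<in> A \<Longrightarrow> 0 \<le> w k / W" using w Wp by simp
  have "emeasure N (space N) = (\<Sum>k\<in>A. ennreal (w k / W))"
    unfolding N_def space_point_measure
    by (rule emeasure_point_measure_finite2[OF order_refl fin])
  also have "\<dots> = ennreal (\<Sum>k\<in>A. w k / W)" by (rule sum_ennreal) (use wW in auto)
  also have "(\<Sum>k\<in>A. w k / W) = 1" using Wp by (simp add: W_def flip: sum_divide_distrib)
  finally interpret N: prob_space N by (intro prob_spaceI) simp
  interpret interval_bounded_random_variable N g lo "lo + R"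
  proof
    show "g \<in> borel_measurable N" by (simp add: N_def)
    show "AE x in N. g x \<in> {lo..lo + R}"
      by (rule AE_I2) (use g in \<open>auto simp: N_def space_point_measure\<close>)
  qed
  have E: "N.expectation g = (\<Sum>k\<in>A. w k * g k) / W"
    unfolding N_def by (subst lebesgue_integral_point_measure_finite) (use fin wW in \<open>auto simp: sum_divide_distrib\<close>)
  define m where "m = (\<Sum>k\<in>A. w k * g k) / W"
  have "ennreal (\<Sum>k\<in>A. w k / W * exp (t * (g k - m))) = (\<Sum>k\<in>A. ennreal (w k / W) * ennreal (exp (t * (g k - m))))"
    by (subst sum_ennreal[symmetric]) (use w Wp in \<open>auto simp: divide_nonneg_pos simp flip: ennreal_mult\<close>)
  also have "\<dots> = (\<integral>\<^sup>+ k. ennreal (exp (t * (g k - m))) \<partial>N)"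
    unfolding N_def by (rule nn_integral_point_measure_finite[OF fin, symmetric])
  also have "\<dots> \<le> ennreal (exp (t\<^sup>2 * R\<^sup>2 / 8))"
    using Hoeffdings_lemma_nn_integral[OF t] by (simp add: E m_def)
  finally have "(\<Sum>k\<in>A. w k / W * exp (t * (g k - m))) \<le> exp (t\<^sup>2 * R\<^sup>2 / 8)" by simp
  hence "W * (\<Sum>k\<in>A. w k / W * exp (t * (g k - m))) \<le> W * exp (t\<^sup>2 * R\<^sup>2 / 8)"
    using Wp by (intro mult_left_mono) auto
  also have "W * (\<Sum>k\<in>A. w k / W * exp (t * (g k - m))) = (\<Sum>k\<in>A. w k * exp (t * (g k - m)))"
    using Wp by (simp add: sum_distrib_left)
  finally show ?thesis unfolding m_def W_def .
qed

lemma hoeffding_weighted_mean: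
  fixes w g :: "'a \<Rightarrow> real"
  assumes fin: "finite A" and w: "\<And>k. k \<in> A \<Longrightarrow> 0 \<le> w k" and W: "0 < sum w A"
    and g: "\<And>k. k \<in> A \<Longrightarrow> lo \<le> g k \<and> g k \<le> lo + R"
  shows "(\<Sum>k\<in>A. w k * exp (t * (g k - (\<Sum>k\<in>A. w k * g k) / sum w A)))
           \<le> sum w A * exp (t\<^sup>2 * R\<^sup>2 / 8)"
proof -
  consider "t > 0" | "t = 0" | "- t > 0" by linarith
  thus ?thesis
  proof cases
    case 1 show ?thesis by (rule hoeffding_weighted_mean_pos[OF fin w W g 1])
  next
    case 3
    have neg: "- (lo + R) \<le> - g k \<and> - g k \<le> - (lo + R) + R" if "k \<in> A" for k using g[OF that] by auto
    have "(\<Sum>k\<in>A. w k * exp (- t * (- g k - (\<Sum>k\<in>A. w k * - g k) / sum w A)))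
           \<le> sum w A * exp ((- t)\<^sup>2 * R\<^sup>2 / 8)"
      by (rule hoeffding_weighted_mean_pos[where lo = "- (lo + R)"]) (use fin w W neg 3 in auto)
    thus ?thesis by (simp add: sum_negf algebra_simps)
  qed simp
qed

definition bij_from :: "nat \<Rightarrow> nat set \<Rightarrow> (nat \<Rightarrow> nat) set" where
  "bij_from m R = {f. bij_betw f {..<m} R \<and> (\<forall>i\<ge>m. f i = i)}"

lemma bij_from_lessThan: "bij_from n {..<n} = {p. p permutes {..<n}}"
proof (intro set_eqI iffI)
  fix p assume "p \<in> bij_from n {..<n}"
  thus "p \<in> {p. p permutes {..<n}}" by (auto simp: bij_from_def not_less[symmetric] intro!: bij_imp_permutes)
next
  fix p assume "p \<in> {p. p permutes {..<n}}"
  hence p: "p permutes {..<n}" by simp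
  show "p \<in> bij_from n {..<n}"
    using permutes_imp_bij[OF p] permutes_not_in[OF p] by (simp add: bij_from_def)
qed

lemma bij_from_Suc:
  "bij_betw (\<lambda>(k, f). f(m := k)) (SIGMA k:R. bij_from m (R - {k})) (bij_from (Suc m) R)"
proof (rule bij_betwI[where g = "\<lambda>f. (f m, f(m := m))"])
  show "(\<lambda>(k, f). f(m := k)) \<in> (SIGMA k:R. bij_from m (R - {k})) \<rightarrow> bij_from (Suc m) R"
  proof (clarsimp simp: bij_from_def)
    fix k f assume k: "k \<in> R" and f: "bij_betw f {..<m} (R - {k})"
    have "bij_betw (f(m := k)) {..<m} (R - {k})"
      using f by (rule bij_betw_cong[THEN iffD1, rotated]) auto
    from notIn_Un_bij_betw[of m "{..<m}" "f(m:=k)", OF _ _ this]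
    show "bij_betw (f(m := k)) {..<Suc m} R"
      using k by (simp add: lessThan_Suc insert_absorb)
  qed
  show "(\<lambda>f. (f m, f(m := m))) \<in> bij_from (Suc m) R \<rightarrow> (SIGMA k:R. bij_from m (R - {k}))"
  proof (clarsimp simp: bij_from_def)
    fix f assume f: "bij_betw f {..<Suc m} R"
    have "f m \<in> R" using f by (auto dest: bij_betwE)
    moreover have "bij_betw f {..<m} (R - {f m})"
      using f unfolding bij_betw_def lessThan_Suc by (auto simp: inj_on_def)
    hence "bij_betw (f(m := m)) {..<m} (R - {f m})"
      by (rule bij_betw_cong[THEN iffD1, rotated]) auto
    ultimately show "f m \<in> R \<and> bij_betw (f(m := m)) {..<m} (R - {f m})" by blast
  qed
qed (auto simp: bij_from_def fun_eq_iff)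

lemma finite_bij_from: "finite R \<Longrightarrow> finite (bij_from m R)"
proof (induction m arbitrary: R)
  case 0
  have "bij_from 0 R \<subseteq> {id}" by (auto simp: bij_from_def)
  thus ?case by (rule finite_subset) simp
next
  case (Suc m)
  hence "finite (SIGMA k:R. bij_from m (R - {k}))" by auto
  thus ?case using bij_from_Suc bij_betw_finite by blast
qed

text \<open>Fill the positions from the last one down: \<open>f ` {..i}\<close> is then the set of labels still
  available when position \<open>i\<close> is drawn.\<close>

lemma sum_bij_from_prod_le:
  fixes h :: "nat \<Rightarrow> nat set \<Rightarrow> nat \<Rightarrow> real"
  assumes "\<And>i S k. i < m \<Longrightarrow> S \<subseteq> R \<Longrightarrow> k \<in> S \<Longrightarrow> 0 \<le> h i S k"
    and "\<And>i S. i < m \<Longrightarrow> S \<subseteq> R \<Longrightarrow> (\<Sum>k\<in>S. h i S k) \<le> M i"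
    and "\<And>i. i < m \<Longrightarrow> 0 \<le> M i" and "finite R"
  shows "(\<Sum>f\<in>bij_from m R. \<Prod>i<m. h i (f ` {..i}) (f i)) \<le> (\<Prod>i<m. M i)"
  using assms
proof (induction m arbitrary: R)
  case 0
  have "bij_from 0 R \<subseteq> {id}" by (auto simp: bij_from_def)
  hence "card (bij_from 0 R) \<le> card {id :: nat \<Rightarrow> nat}" by (intro card_mono) auto
  thus ?case by simp
next
  case (Suc m)
  have fin: "finite (bij_from m (R - {k}))" for k using Suc.prems(4) by (intro finite_bij_from) auto
  have "(\<Sum>f\<in>bij_from (Suc m) R. \<Prod>i<Suc m. h i (f ` {..i}) (f i))
      = (\<Sum>(k,f)\<in>(SIGMA k:R. bij_from m (R - {k})). \<Prod>i<Suc m. h i ((f(m:=k)) ` {..i}) ((f(m:=k)) i))"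
    by (rule trans[OF sum.reindex_bij_betw[OF bij_from_Suc, symmetric]]) (simp only: case_prod_unfold)
  also have "\<dots> = (\<Sum>k\<in>R. \<Sum>f\<in>bij_from m (R - {k}).
               \<Prod>i<Suc m. h i ((f(m:=k)) ` {..i}) ((f(m:=k)) i))"
    by (rule sum.Sigma[symmetric]) (use Suc.prems(4) fin in auto)
  also have "\<dots> = (\<Sum>k\<in>R. \<Sum>f\<in>bij_from m (R - {k}). h m R k * (\<Prod>i<m. h i (f ` {..i}) (f i)))"
  proof (intro sum.cong refl)
    fix k f assume k: "k \<in> R" and f: "f \<in> bij_from m (R - {k})"
    have "(f(m:=k)) ` {..m} = insert k (f ` {..<m})" by (auto simp: atMost_Suc_eq_insert_0 le_less)
    also have "f ` {..<m} = R - {k}" using f by (auto simp: bij_from_def bij_betw_def)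
    finally have 1: "(f(m:=k)) ` {..m} = R" using k by auto
    have 2: "(\<Prod>i<m. h i ((f(m:=k)) ` {..i}) ((f(m:=k)) i)) = (\<Prod>i<m. h i (f ` {..i}) (f i))"
    proof (intro prod.cong refl)
      fix i assume i: "i \<in> {..<m}"
      have "(f(m:=k)) ` {..i} = f ` {..i}" using i by (intro image_cong) auto
      thus "h i ((f(m:=k)) ` {..i}) ((f(m:=k)) i) = h i (f ` {..i}) (f i)" using i by simp
    qed
    show "(\<Prod>i<Suc m. h i ((f(m:=k)) ` {..i}) ((f(m:=k)) i)) = h m R k * (\<Prod>i<m. h i (f ` {..i}) (f i))"
      unfolding prod.lessThan_Suc 2 1 by (simp add: mult.commute)
  qed
  also have "\<dots> = (\<Sum>k\<in>R. h m R k * (\<Sum>f\<in>bij_from m (R - {k}). \<Prod>i<m. h i (f ` {..i}) (f i)))"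
    by (simp add: sum_distrib_left)
  also have "\<dots> \<le> (\<Sum>k\<in>R. h m R k * (\<Prod>i<m. M i))"
  proof (intro sum_mono mult_left_mono)
    fix k assume k: "k \<in> R"
    show "(\<Sum>f\<in>bij_from m (R - {k}). \<Prod>i<m. h i (f ` {..i}) (f i)) \<le> (\<Prod>i<m. M i)"
      using Suc.prems by (intro Suc.IH) (auto simp: subset_Diff_insert)
    show "0 \<le> h m R k" using Suc.prems k by auto
  qed
  also have "\<dots> = (\<Sum>k\<in>R. h m R k) * (\<Prod>i<m. M i)" by (simp add: sum_distrib_right)
  also have "\<dots> \<le> M m * (\<Prod>i<m. M i)"
    using Suc.prems by (intro mult_right_mono prod_nonneg) auto
  finally show ?case by (simp add: mult.commute)
qed

lemma sum_class_share_le: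
  fixes w G :: "'a \<Rightarrow> real" and c :: "'a \<Rightarrow> 'b"
  assumes fin: "finite A" and RA: "R \<subseteq> A" and w: "\<And>k. k \<in> A \<Longrightarrow> 0 < w k"
    and G: "\<And>k. k \<in> A \<Longrightarrow> 0 \<le> G k"
    and Gc: "\<And>k l. k \<in> A \<Longrightarrow> l \<in> A \<Longrightarrow> c k = c l \<Longrightarrow> G k = G l"
  shows "(\<Sum>k\<in>R. w k * G k * (\<Sum>l\<in>{l\<in>A. c l = c k}. w l) / (\<Sum>l\<in>{l\<in>R. c l = c k}. w l))
           \<le> (\<Sum>k\<in>A. w k * G k)"
proof -
  have finR: "finite R" using fin RA finite_subset by blast
  have "(\<Sum>k\<in>R. w k * G k * (\<Sum>l\<in>{l\<in>A. c l = c k}. w l) / (\<Sum>l\<in>{l\<in>R. c l = c k}. w l))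
     = (\<Sum>b\<in>c ` R. \<Sum>k\<in>{k\<in>R. c k = b}. w k * G k * (\<Sum>l\<in>{l\<in>A. c l = c k}. w l) / (\<Sum>l\<in>{l\<in>R. c l = c k}. w l))"
    by (rule sum.image_gen[OF finR])
  also have "\<dots> = (\<Sum>b\<in>c ` R. \<Sum>k\<in>{k\<in>A. c k = b}. w k * G k)"
  proof (rule sum.cong[OF refl])
    fix b assume "b \<in> c ` R"
    then obtain r where r: "r \<in> R" "c r = b" by auto
    have pos: "0 < (\<Sum>l\<in>{l\<in>R. c l = b}. w l)"
      using finR r RA w by (intro sum_pos) auto
    have Gr: "G k = G r" if "k \<in> A" "c k = b" for k using Gc[of k r] that r RA by auto
    have "(\<Sum>k\<in>{k\<in>R. c k = b}. w k * G k * (\<Sum>l\<in>{l\<in>A. c l = c k}. w l) / (\<Sum>l\<in>{l\<in>R. c l = c k}. w l))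
       = (\<Sum>k\<in>{k\<in>R. c k = b}. w k * (G r * (\<Sum>l\<in>{l\<in>A. c l = b}. w l) / (\<Sum>l\<in>{l\<in>R. c l = b}. w l)))"
      by (rule sum.cong[OF refl]) (use Gr RA in auto)
    also have "\<dots> = G r * (\<Sum>l\<in>{l\<in>A. c l = b}. w l)"
      unfolding sum_distrib_right[symmetric] using pos by simp
    also have "\<dots> = (\<Sum>k\<in>{k\<in>A. c k = b}. w k * G k)"
      unfolding sum_distrib_left by (rule sum.cong[OF refl]) (use Gr in auto)
    finally show "(\<Sum>k\<in>{k\<in>R. c k = b}. w k * G k * (\<Sum>l\<in>{l\<in>A. c l = c k}. w l) / (\<Sum>l\<in>{l\<in>R. c l = c k}. w l))
      = (\<Sum>k\<in>{k\<in>A. c k = b}. w k * G k)" .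
  qed
  also have "\<dots> \<le> (\<Sum>b\<in>c ` A. \<Sum>k\<in>{k\<in>A. c k = b}. w k * G k)"
    by (rule sum_mono2) (use fin RA less_imp_le[OF w] G in \<open>auto intro!: sum_nonneg mult_nonneg_nonneg\<close>)
  also have "\<dots> = (\<Sum>k\<in>A. w k * G k)" by (rule sum.image_gen[OF fin, symmetric])
  finally show ?thesis .
qed

lemma sum_permutes_single:
  fixes g :: "nat \<Rightarrow> real"
  assumes i: "i < n"
  shows "real n * (\<Sum>p\<in>{p. p permutes {..<n}}. g (p i)) = fact n * (\<Sum>k<n. g k)"
proof -
  let ?P = "{p. p permutes {..<n}}"
  have eq: "(\<Sum>p\<in>?P. g (p i)) = (\<Sum>p\<in>?P. g (p i'))" if "i' < n" for i'
    using sum_permutations_compose_right[of "Transposition.transpose i i'" "{..<n}" "\<lambda>p. g (p i')"] that i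
    by (simp add: permutes_swap_id)
  have "real n * (\<Sum>p\<in>?P. g (p i)) = (\<Sum>i'<n. \<Sum>p\<in>?P. g (p i))" by simp
  also have "\<dots> = (\<Sum>i'<n. \<Sum>p\<in>?P. g (p i'))"
    by (rule sum.cong[OF refl]) (rule eq, simp)
  also have "\<dots> = (\<Sum>p\<in>?P. \<Sum>i'<n. g (p i'))" by (rule sum.swap)
  also have "\<dots> = (\<Sum>p\<in>?P. \<Sum>k<n. g k)"
    by (rule sum.cong[OF refl]) (simp add: sum.permute[of _ "{..<n}" g] o_def)
  also have "\<dots> = fact n * (\<Sum>k<n. g k)"
    by (simp add: card_permutations)
  finally show ?thesis .
qed

lemma sum_permutes_pair:
  fixes g :: "nat \<Rightarrow> nat \<Rightarrow> real"
  assumes i: "i < n" and j: "j < n" and ij: "i \<noteq> j"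
  shows "real n * (real n - 1) * (\<Sum>p\<in>{p. p permutes {..<n}}. g (p i) (p j))
           = fact n * (\<Sum>k<n. \<Sum>l<n. if k = l then 0 else g k l)"
proof -
  let ?P = "{p. p permutes {..<n}}"
  have eq: "(\<Sum>p\<in>?P. g (p i') (p j')) = (\<Sum>p\<in>?P. g (p i) (p j))"
    if ij': "i' < n" "j' < n" "i' \<noteq> j'" for i' j'
  proof -
    define j1 where "j1 = Transposition.transpose i i' j"
    define s where "s = Transposition.transpose j1 j' \<circ> Transposition.transpose i i'"
    have "j1 < n" using i j ij' by (auto simp: j1_def Transposition.transpose_def)
    have j1: "j1 \<noteq> i'" using ij by (auto simp: j1_def Transposition.transpose_def split: if_splits)
    have "s permutes {..<n}" unfolding s_def
      using i ij' \<open>j1 < n\<close> by (intro permutes_compose permutes_swap_id) auto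
    moreover have "s i = i'" "s j = j'"
      using j1 ij' by (auto simp: s_def j1_def[symmetric])
    ultimately show ?thesis
      using sum_permutations_compose_right[of s "{..<n}" "\<lambda>p. g (p i) (p j)"] by simp
  qed
  have "(\<Sum>i'<n. \<Sum>j'<n. if i' = j' then 0 else \<Sum>p\<in>?P. g (p i') (p j'))
      = (\<Sum>i'<n. \<Sum>j'<n. if i' = j' then 0 else \<Sum>p\<in>?P. g (p i) (p j))"
    using eq by (intro sum.cong refl) auto
  also have "\<dots> = (\<Sum>i'<n. \<Sum>j'\<in>{..<n} - {i'}. \<Sum>p\<in>?P. g (p i) (p j))"
    by (intro sum.cong refl sum.mono_neutral_cong_right) auto
  also have "\<dots> = real n * (real n - 1) * (\<Sum>p\<in>?P. g (p i) (p j))"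
    using i by (simp add: of_nat_diff)
  finally have "real n * (real n - 1) * (\<Sum>p\<in>?P. g (p i) (p j))
      = (\<Sum>i'<n. \<Sum>j'<n. if i' = j' then 0 else \<Sum>p\<in>?P. g (p i') (p j'))" by simp
  also have "\<dots> = (\<Sum>i'<n. \<Sum>j'<n. \<Sum>p\<in>?P. if i' = j' then 0 else g (p i') (p j'))"
    by (intro sum.cong refl) auto
  also have "\<dots> = (\<Sum>i'<n. \<Sum>p\<in>?P. \<Sum>j'<n. if i' = j' then 0 else g (p i') (p j'))"
    by (intro sum.cong refl sum.swap)
  also have "\<dots> = (\<Sum>p\<in>?P. \<Sum>i'<n. \<Sum>j'<n. if i' = j' then 0 else g (p i') (p j'))"
    by (rule sum.swap)
  also have "\<dots> = (\<Sum>p\<in>?P. \<Sum>k<n. \<Sum>l<n. if k = l then 0 else g k l)"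
  proof (rule sum.cong[OF refl])
    fix p assume "p \<in> ?P"
    hence p: "p permutes {..<n}" by simp
    have "(\<Sum>k<n. \<Sum>l<n. if k = l then 0 else g k l) = (\<Sum>k<n. \<Sum>l<n. if p k = l then 0 else g (p k) l)"
      by (subst sum.permute[OF p]) (simp add: o_def)
    also have "\<dots> = (\<Sum>k<n. \<Sum>l<n. if p k = p l then 0 else g (p k) (p l))"
      by (rule sum.cong[OF refl]) (subst sum.permute[OF p], simp add: o_def)
    also have "\<dots> = (\<Sum>k<n. \<Sum>l<n. if k = l then 0 else g (p k) (p l))"
      using permutes_inj[OF p] by (simp add: inj_eq)
    finally show "(\<Sum>i'<n. \<Sum>j'<n. if i' = j' then 0 else g (p i') (p j')) = (\<Sum>k<n. \<Sum>l<n. if k = l then 0 else g k l)"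
      by simp
  qed
  also have "\<dots> = fact n * (\<Sum>k<n. \<Sum>l<n. if k = l then 0 else g k l)"
    by (simp add: card_permutations)
  finally show ?thesis .
qed

lemma sum_permutes_class_ratio_le:
  fixes w :: "nat \<Rightarrow> real" and c :: "nat \<Rightarrow> 'b"
  assumes n: "2 \<le> n" and i: "i < n" and w: "\<And>k. k < n \<Longrightarrow> 0 < w k"
  defines "W \<equiv> \<lambda>k. \<Sum>l\<in>{l\<in>{..<n}. c l = c k}. w l"
  shows "(\<Sum>p\<in>{p. p permutes {..<n}}.
             w (p i) * (((\<Sum>j\<le>i. if c (p j) = c (p i) then w (p j) else 0) / real (Suc i)) / (W (p i) / real n)))
           \<le> fact n * (((\<Sum>k<n. (w k)\<^sup>2 / W k) + real i * (\<Sum>k<n. w k) / (real n - 1)) / real (Suc i))"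
proof -
  let ?P = "{p. p permutes {..<n}}"
  have Wpos: "W k > 0" if "k < n" for k
    unfolding W_def using that w by (intro sum_pos) auto
  define g where "g k l = (if c l = c k then w k * w l * real n / W k else 0)" for k l
  have g0: "0 \<le> g k l" if "k < n" "l < n" for k l
    using that Wpos[of k] w[of k] w[of l] by (simp add: g_def)
  have "(\<Sum>p\<in>?P. w (p i) * (((\<Sum>j\<le>i. if c (p j) = c (p i) then w (p j) else 0) / real (Suc i)) / (W (p i) / real n)))
      = (\<Sum>p\<in>?P. (\<Sum>j\<le>i. g (p i) (p j)) / real (Suc i))"
    by (intro sum.cong refl)
       (auto simp: g_def sum_distrib_left sum_distrib_right sum_divide_distrib mult_ac intro!: sum.cong)
  also have "\<dots> = (\<Sum>j\<le>i. \<Sum>p\<in>?P. g (p i) (p j)) / real (Suc i)"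
    by (subst sum.swap) (simp add: sum_divide_distrib)
  also have "(\<Sum>j\<le>i. \<Sum>p\<in>?P. g (p i) (p j)) = (\<Sum>p\<in>?P. g (p i) (p i)) + (\<Sum>j<i. \<Sum>p\<in>?P. g (p i) (p j))"
    by (simp add: lessThan_Suc_atMost[symmetric])
  also have "(\<Sum>p\<in>?P. g (p i) (p i)) = fact n * (\<Sum>k<n. (w k)\<^sup>2 / W k)"
  proof -
    have "real n * (\<Sum>p\<in>?P. g (p i) (p i)) = fact n * (\<Sum>k<n. g k k)"
      by (rule sum_permutes_single[OF i])
    also have "(\<Sum>k<n. g k k) = real n * (\<Sum>k<n. (w k)\<^sup>2 / W k)"
      by (simp add: g_def sum_distrib_left power2_eq_square mult_ac)
    finally show ?thesis using n by simp
  qed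
  also have "(\<Sum>j<i. \<Sum>p\<in>?P. g (p i) (p j)) \<le> (\<Sum>j<i. fact n * ((\<Sum>k<n. w k) / (real n - 1)))"
  proof (rule sum_mono)
    fix j assume j: "j \<in> {..<i}"
    have "real n * (real n - 1) * (\<Sum>p\<in>?P. g (p i) (p j))
           = fact n * (\<Sum>k<n. \<Sum>l<n. if k = l then 0 else g k l)"
      by (rule sum_permutes_pair) (use i j in auto)
    also have "\<dots> \<le> fact n * (\<Sum>k<n. \<Sum>l<n. g k l)"
      using g0 by (intro mult_left_mono sum_mono) auto
    also have "(\<Sum>k<n. \<Sum>l<n. g k l) = (\<Sum>k<n. real n * w k)"
    proof (rule sum.cong[OF refl])
      fix k assume k: "k \<in> {..<n}"
      have "(\<Sum>l<n. g k l) = (\<Sum>l\<in>{l\<in>{..<n}. c l = c k}. real n * w k / W k * w l)"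
        by (rule sum.mono_neutral_cong_right) (auto simp: g_def)
      also have "\<dots> = real n * w k"
        unfolding sum_distrib_left[symmetric] using Wpos[of k] k by (simp add: W_def)
      finally show "(\<Sum>l<n. g k l) = real n * w k" .
    qed
    finally have "real n * ((real n - 1) * (\<Sum>p\<in>?P. g (p i) (p j))) \<le> real n * (fact n * (\<Sum>k<n. w k))"
      by (simp add: sum_distrib_left[symmetric] mult_ac)
    hence "(real n - 1) * (\<Sum>p\<in>?P. g (p i) (p j)) \<le> fact n * (\<Sum>k<n. w k)"
      using n by simp
    thus "(\<Sum>p\<in>?P. g (p i) (p j)) \<le> fact n * ((\<Sum>k<n. w k) / (real n - 1))"
      using n by (simp add: field_simps)
  qed
  finally show ?thesis
    by (simp add: divide_right_mono algebra_simps)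
qed

lemma sum_square_over_class_le:
  fixes w :: "nat \<Rightarrow> real" and c :: "nat \<Rightarrow> 'b"
  assumes fin: "finite A" and w: "\<And>k. k \<in> A \<Longrightarrow> 0 < w k" and B: "\<And>k. k \<in> A \<Longrightarrow> w k \<le> B (c k)"
  shows "(\<Sum>k\<in>A. (w k)\<^sup>2 / (\<Sum>l\<in>{l\<in>A. c l = c k}. w l)) \<le> (\<Sum>b\<in>c ` A. B b)"
proof -
  have "(\<Sum>k\<in>A. (w k)\<^sup>2 / (\<Sum>l\<in>{l\<in>A. c l = c k}. w l))
      = (\<Sum>b\<in>c ` A. \<Sum>k\<in>{k\<in>A. c k = b}. (w k)\<^sup>2 / (\<Sum>l\<in>{l\<in>A. c l = c k}. w l))"
    by (rule sum.image_gen[OF fin])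
  also have "\<dots> \<le> (\<Sum>b\<in>c ` A. B b)"
  proof (rule sum_mono)
    fix b assume "b \<in> c ` A"
    then obtain r where r: "r \<in> A" "c r = b" by auto
    have pos: "0 < (\<Sum>l\<in>{l\<in>A. c l = b}. w l)"
      using fin r w by (intro sum_pos) auto
    have "(\<Sum>k\<in>{k\<in>A. c k = b}. (w k)\<^sup>2 / (\<Sum>l\<in>{l\<in>A. c l = c k}. w l))
       = (\<Sum>k\<in>{k\<in>A. c k = b}. (w k)\<^sup>2) / (\<Sum>l\<in>{l\<in>A. c l = b}. w l)"
      by (simp add: sum_divide_distrib)
    also have "\<dots> \<le> (\<Sum>k\<in>{k\<in>A. c k = b}. B b * w k) / (\<Sum>l\<in>{l\<in>A. c l = b}. w l)"
      using pos w B by (intro divide_right_mono sum_mono) (auto simp: power2_eq_square intro!: mult_right_mono less_imp_le[OF w])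
    also have "\<dots> = B b" using pos by (simp flip: sum_distrib_left)
    finally show "(\<Sum>k\<in>{k\<in>A. c k = b}. (w k)\<^sup>2 / (\<Sum>l\<in>{l\<in>A. c l = c k}. w l)) \<le> B b" .
  qed
  finally show ?thesis .
qed

lemma normal_density_le_wider:
  fixes t u x :: real
  assumes "\<bar>t - u\<bar> \<le> 1"
  shows "normal_density t 1 x \<le> 3 * normal_density u (sqrt 2) x"
proof -
  have "(t - u)\<^sup>2 \<le> 1" using assms by (simp add: abs_square_le_1)
  moreover have "0 \<le> (x - 2 * t + u)\<^sup>2" by simp
  ultimately have 1: "- (x - t)\<^sup>2 / 2 \<le> 1 / 2 + - (x - u)\<^sup>2 / 4"
    by (simp add: power2_eq_square field_simps)
  have "(sqrt 2 * exp (1 / 2 :: real))\<^sup>2 = 2 * exp 1"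
    by (simp add: power_mult_distrib flip: exp_double)
  also have "\<dots> \<le> 3\<^sup>2" using exp_le by simp
  finally have 2: "sqrt 2 * exp (1 / 2 :: real) \<le> 3" by (rule power2_le_imp_le) simp
  have "exp (- (x - t)\<^sup>2 / 2) \<le> exp (1 / 2) * exp (- (x - u)\<^sup>2 / 4)"
    using 1 by (simp flip: exp_add)
  also have "\<dots> = (sqrt 2 * exp (1 / 2)) * exp (- (x - u)\<^sup>2 / 4) / sqrt 2" by simp
  also have "\<dots> \<le> 3 * exp (- (x - u)\<^sup>2 / 4) / sqrt 2"
    using 2 by (intro divide_right_mono mult_right_mono) auto
  finally have "exp (- (x - t)\<^sup>2 / 2) / sqrt (2 * pi) \<le> (3 * exp (- (x - u)\<^sup>2 / 4) / sqrt 2) / sqrt (2 * pi)"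
    by (rule divide_right_mono) simp
  also have "\<dots> = 3 * exp (- (x - u)\<^sup>2 / 4) / (sqrt (2 * (2 * pi)))"
    by (simp add: real_sqrt_mult)
  finally show ?thesis by (simp add: normal_density_def mult_ac)
qed

lemma sum_inverse_Suc_le_ln:
  assumes "0 < n"
  shows "(\<Sum>i<n. 1 / real (Suc i)) \<le> 1 + ln (real n)"
proof -
  obtain m where m: "n = Suc m" using assms by (cases n) auto
  have "harm (Suc m) - ln (real (Suc m)) \<le> harm (Suc 0) - ln (real (Suc 0))"
    using decseq_harm_diff_ln by (rule decseqD) simp
  thus ?thesis by (simp add: m harm_altdef inverse_eq_divide)
qed

subsection \<open>Integration over the sample space\<close>

lemma PiM_density_lborel:
  fixes f :: "'i \<Rightarrow> real \<Rightarrow> ennreal"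
  assumes I: "finite I" and f[measurable]: "\<And>i. i \<in> I \<Longrightarrow> f i \<in> borel_measurable borel"
    and prob: "\<And>i. prob_space (density lborel (f i))"
  shows "density (\<Pi>\<^sub>M i\<in>I. lborel) (\<lambda>x. \<Prod>i\<in>I. f i (x i)) = (\<Pi>\<^sub>M i\<in>I. density lborel (f i))"
proof -
  interpret D: product_sigma_finite "\<lambda>i. density lborel (f i)"
    unfolding product_sigma_finite_def using prob by (auto intro: prob_space_imp_sigma_finite)
  interpret B: product_sigma_finite "\<lambda>i::'i. lborel :: real measure"
    unfolding product_sigma_finite_def using sigma_finite_lborel by auto
  show ?thesis
  proof (rule D.PiM_eqI[OF I])
    show "sets (density (\<Pi>\<^sub>M i\<in>I. lborel) (\<lambda>x. \<Prod>i\<in>I. f i (x i))) = sets (\<Pi>\<^sub>M i\<in>I. density lborel (f i))"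
      by (simp cong: sets_PiM_cong)
    fix A :: "'i \<Rightarrow> real set" assume "\<And>i. i \<in> I \<Longrightarrow> A i \<in> sets (density lborel (f i))"
    hence A[measurable]: "\<And>i. i \<in> I \<Longrightarrow> A i \<in> sets borel" by simp
    have "emeasure (density (\<Pi>\<^sub>M i\<in>I. lborel) (\<lambda>x. \<Prod>i\<in>I. f i (x i))) (Pi\<^sub>E I A)
        = (\<integral>\<^sup>+x. (\<Prod>i\<in>I. f i (x i)) * indicator (Pi\<^sub>E I A) x \<partial>(\<Pi>\<^sub>M i\<in>I. lborel))"
      using I by (intro emeasure_density) (auto intro!: sets_PiM_I_finite)
    also have "\<dots> = (\<integral>\<^sup>+x. (\<Prod>i\<in>I. f i (x i) * indicator (A i) (x i)) \<partial>(\<Pi>\<^sub>M i\<in>I. lborel))"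
    proof (intro nn_integral_cong)
      fix x :: "'i \<Rightarrow> real" assume x: "x \<in> space (\<Pi>\<^sub>M i\<in>I. lborel)"
      have "indicator (Pi\<^sub>E I A) x = (\<Prod>i\<in>I. indicator (A i) (x i) :: ennreal)"
        using x I by (auto simp: space_PiM PiE_iff indicator_def prod_zero)
      thus "(\<Prod>i\<in>I. f i (x i)) * indicator (Pi\<^sub>E I A) x = (\<Prod>i\<in>I. f i (x i) * indicator (A i) (x i))"
        by (simp add: prod.distrib)
    qed
    also have "\<dots> = (\<Prod>i\<in>I. \<integral>\<^sup>+x. f i x * indicator (A i) x \<partial>lborel)"
      by (rule B.product_nn_integral_prod[OF I]) measurable
    also have "\<dots> = (\<Prod>i\<in>I. emeasure (density lborel (f i)) (A i))"
      by (intro prod.cong refl emeasure_density[symmetric]) auto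
    finally show "emeasure (density (\<Pi>\<^sub>M i\<in>I. lborel) (\<lambda>x. \<Prod>i\<in>I. f i (x i))) (Pi\<^sub>E I A)
      = (\<Prod>i\<in>I. emeasure (density lborel (f i)) (A i))" .
  qed
qed

lemma density_normal_shift:
  "distr (density lborel std_normal_density) borel (\<lambda>z. t + z) = density lborel (normal_density t 1)"
proof (rule measure_eqI)
  fix A assume "A \<in> sets (distr (density lborel std_normal_density) borel (\<lambda>z. t + z))"
  hence A[measurable]: "A \<in> sets borel" by simp
  have "emeasure (distr (density lborel std_normal_density) borel (\<lambda>z. t + z)) A
      = (\<integral>\<^sup>+z. ennreal (std_normal_density z) * indicator A (t + z) \<partial>lborel)"
  proof -
    have "(\<lambda>z. t + z) -` A \<inter> space borel \<in> sets borel" by measurable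
    hence "(\<lambda>z. t + z) -` A \<in> sets borel" by simp
    thus ?thesis
      by (subst emeasure_distr) (auto simp: emeasure_density intro!: nn_integral_cong split: split_indicator)
  qed
  also have "\<dots> = (\<integral>\<^sup>+z. ennreal (normal_density t 1 (t + 1 * z)) * indicator A (t + 1 * z) \<partial>lborel)"
    by (simp add: normal_density_def)
  also have "\<dots> = (\<integral>\<^sup>+x. ennreal (normal_density t 1 x) * indicator A x \<partial>lborel)"
    using nn_integral_real_affine[of "\<lambda>x. ennreal (normal_density t 1 x) * indicator A x" 1 t] by simp
  also have "\<dots> = emeasure (density lborel (normal_density t 1)) A"
    by (rule emeasure_density[symmetric]) auto
  finally show "emeasure (distr (density lborel std_normal_density) borel (\<lambda>z. t + z)) A
      = emeasure (density lborel (normal_density t 1)) A" .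
qed simp

lemma prob_space_std_normal: "prob_space (density lborel std_normal_density)"
  by (rule prob_space_normal_density) simp

lemma distr_PiM_normal_shift:
  fixes t :: "nat \<Rightarrow> real"
  shows "distr (\<Pi>\<^sub>M i\<in>{..<n}. density lborel std_normal_density) (\<Pi>\<^sub>M i\<in>{..<n}. borel)
             (\<lambda>z. restrict (\<lambda>i. t i + z i) {..<n})
           = (\<Pi>\<^sub>M i\<in>{..<n}. density lborel (normal_density (t i) 1))"
proof -
  let ?S = "\<Pi>\<^sub>M i\<in>{..<n}. density lborel std_normal_density"
  interpret D: product_sigma_finite "\<lambda>i. density lborel (normal_density (t i) 1)"
    unfolding product_sigma_finite_def
    by (auto intro!: prob_space_imp_sigma_finite prob_space_normal_density)
  interpret S: product_sigma_finite "\<lambda>i::nat. density lborel std_normal_density"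
    unfolding product_sigma_finite_def
    by (auto intro!: prob_space_imp_sigma_finite prob_space_normal_density)
  show ?thesis
  proof (rule D.PiM_eqI)
    show "sets (distr ?S (\<Pi>\<^sub>M i\<in>{..<n}. borel) (\<lambda>z. restrict (\<lambda>i. t i + z i) {..<n}))
       = sets (\<Pi>\<^sub>M i\<in>{..<n}. density lborel (normal_density (t i) 1))"
      by (simp cong: sets_PiM_cong)
    fix A :: "nat \<Rightarrow> real set" assume "\<And>i. i \<in> {..<n} \<Longrightarrow> A i \<in> sets (density lborel (normal_density (t i) 1))"
    hence A[measurable]: "\<And>i. i < n \<Longrightarrow> A i \<in> sets borel" by simp
    have "emeasure (distr ?S (\<Pi>\<^sub>M i\<in>{..<n}. borel) (\<lambda>z. restrict (\<lambda>i. t i + z i) {..<n})) (Pi\<^sub>E {..<n} A)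
        = emeasure ?S ((\<lambda>z. restrict (\<lambda>i. t i + z i) {..<n}) -` (Pi\<^sub>E {..<n} A) \<inter> space ?S)"
      by (rule emeasure_distr) (auto intro!: sets_PiM_I_finite)
    also have "(\<lambda>z. restrict (\<lambda>i. t i + z i) {..<n}) -` (Pi\<^sub>E {..<n} A) \<inter> space ?S
       = Pi\<^sub>E {..<n} (\<lambda>i. (\<lambda>z. t i + z) -` A i)"
      by (auto simp: space_PiM PiE_iff)
    also have "emeasure ?S \<dots> = (\<Prod>i\<in>{..<n}. emeasure (density lborel std_normal_density) ((\<lambda>z. t i + z) -` A i))"
    proof (rule S.emeasure_PiM)
      fix i assume "i \<in> {..<n}"
      hence [measurable]: "A i \<in> sets borel" by simp
      have "(\<lambda>z. t i + z) -` A i \<inter> space borel \<in> sets borel" by measurable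
      thus "(\<lambda>z. t i + z) -` A i \<in> sets (density lborel std_normal_density)" by simp
    qed simp
    also have "\<dots> = (\<Prod>i\<in>{..<n}. emeasure (density lborel (normal_density (t i) 1)) (A i))"
      by (intro prod.cong refl) (subst density_normal_shift[symmetric], subst emeasure_distr, auto)
    finally show "emeasure (distr ?S (\<Pi>\<^sub>M i\<in>{..<n}. borel) (\<lambda>z. restrict (\<lambda>i. t i + z i) {..<n})) (Pi\<^sub>E {..<n} A)
       = (\<Prod>i\<in>{..<n}. emeasure (density lborel (normal_density (t i) 1)) (A i))" .
  qed simp
qed

lemma nn_integral_PiM_normal_shift:
  fixes t :: "nat \<Rightarrow> real"
  assumes H[measurable]: "H \<in> borel_measurable (\<Pi>\<^sub>M i\<in>{..<n}. borel)"
  shows "(\<integral>\<^sup>+z. H (restrict (\<lambda>i. t i + z i) {..<n}) \<partial>(\<Pi>\<^sub>M i\<in>{..<n}. density lborel std_normal_density))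
       = (\<integral>\<^sup>+x. H x * ennreal (\<Prod>i<n. normal_density (t i) 1 (x i)) \<partial>(\<Pi>\<^sub>M i\<in>{..<n}. lborel))"
proof -
  have Hl[measurable]: "H \<in> borel_measurable (\<Pi>\<^sub>M i\<in>{..<n}. lborel)"
    using H by (simp cong: measurable_cong_sets sets_PiM_cong)
  have "(\<integral>\<^sup>+z. H (restrict (\<lambda>i. t i + z i) {..<n}) \<partial>(\<Pi>\<^sub>M i\<in>{..<n}. density lborel std_normal_density))
     = (\<integral>\<^sup>+x. H x \<partial>distr (\<Pi>\<^sub>M i\<in>{..<n}. density lborel std_normal_density) (\<Pi>\<^sub>M i\<in>{..<n}. borel)
             (\<lambda>z. restrict (\<lambda>i. t i + z i) {..<n}))"
    by (rule nn_integral_distr[symmetric]) measurable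
  also have "\<dots> = (\<integral>\<^sup>+x. H x \<partial>density (\<Pi>\<^sub>M i\<in>{..<n}. lborel) (\<lambda>x. \<Prod>i\<in>{..<n}. ennreal (normal_density (t i) 1 (x i))))"
    unfolding distr_PiM_normal_shift
    by (subst PiM_density_lborel) (auto intro!: prob_space_normal_density)
  also have "\<dots> = (\<integral>\<^sup>+x. (\<Prod>i\<in>{..<n}. ennreal (normal_density (t i) 1 (x i))) * H x \<partial>(\<Pi>\<^sub>M i\<in>{..<n}. lborel))"
    by (rule nn_integral_density) measurable
  finally show ?thesis by (simp add: prod_ennreal mult.commute)
qed

lemma nn_integral_PiM_normal_shift_component:
  fixes t :: real
  assumes H[measurable]: "H \<in> borel_measurable borel" and i: "i < n"
  shows "(\<integral>\<^sup>+z. H (t + z i) \<partial>(\<Pi>\<^sub>M i\<in>{..<n}. density lborel std_normal_density))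
       = (\<integral>\<^sup>+x. H x * ennreal (normal_density t 1 x) \<partial>lborel)"
proof -
  have "(\<integral>\<^sup>+z. H (t + z i) \<partial>(\<Pi>\<^sub>M i\<in>{..<n}. density lborel std_normal_density))
    = (\<integral>\<^sup>+y. H (t + y) \<partial>distr (\<Pi>\<^sub>M i\<in>{..<n}. density lborel std_normal_density) (density lborel std_normal_density) (\<lambda>z. z i))"
    by (rule nn_integral_distr[symmetric]) (use i in auto)
  also have "\<dots> = (\<integral>\<^sup>+y. H (t + y) \<partial>density lborel std_normal_density)"
    by (subst distr_PiM_component) (use i prob_space_std_normal in auto)
  also have "\<dots> = (\<integral>\<^sup>+y. H y \<partial>distr (density lborel std_normal_density) borel (\<lambda>z. t + z))"
    by (rule nn_integral_distr[symmetric]) auto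
  also have "\<dots> = (\<integral>\<^sup>+x. ennreal (normal_density t 1 x) * H x \<partial>lborel)"
    unfolding density_normal_shift by (rule nn_integral_density) auto
  finally show ?thesis by (simp add: mult.commute)
qed

lemma prob_space_perm_gauss: "prob_space (perm_gauss_space n)"
proof -
  interpret G: product_prob_space "\<lambda>i::nat. density lborel std_normal_density" "{..<n}"
    unfolding product_prob_space_def product_prob_space_axioms_def product_sigma_finite_def
    by (auto intro!: prob_space_imp_sigma_finite prob_space_normal_density)
  interpret pair_prob_space "measure_pmf (pmf_of_set {p. p permutes {..<n}})"
      "\<Pi>\<^sub>M i\<in>{..<n}. density lborel std_normal_density"
    unfolding pair_prob_space_def pair_sigma_finite_def
    by (auto intro!: prob_space_imp_sigma_finite measure_pmf.prob_space_axioms G.P.prob_space_axioms prob_space_measure_pmf)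
  show ?thesis unfolding perm_gauss_space_def by (rule prob_space_axioms)
qed

lemma measurable_perm_gauss_fst[measurable]:
  "fst \<in> measurable (perm_gauss_space n) (count_space UNIV)"
proof -
  have "fst \<in> measurable (perm_gauss_space n) (measure_pmf (pmf_of_set {p. p permutes {..<n}}))"
    unfolding perm_gauss_space_def by (rule measurable_fst)
  thus ?thesis by (simp cong: measurable_cong_sets)
qed

lemma measurable_perm_gauss_perm[measurable]:
  "(\<lambda>\<omega>. fst \<omega> i) \<in> measurable (perm_gauss_space n) (count_space UNIV)"
  by (rule measurable_compose[OF measurable_perm_gauss_fst]) simp

lemma measurable_perm_gauss_snd:
  "i < n \<Longrightarrow> (\<lambda>\<omega>. snd \<omega> i) \<in> borel_measurable (perm_gauss_space n)"
proof -
  assume "i < n"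
  hence [measurable]: "i \<in> {..<n}" by simp
  have "snd \<in> measurable (perm_gauss_space n) (\<Pi>\<^sub>M i\<in>{..<n}. density lborel std_normal_density)"
    unfolding perm_gauss_space_def by (rule measurable_snd)
  from measurable_compose[OF this measurable_component_singleton[of i]]
  show ?thesis using \<open>i < n\<close> by (simp cong: measurable_cong_sets)
qed

lemma measurable_theta_rv[measurable]: "theta_rv ts i \<in> borel_measurable (perm_gauss_space n)"
  unfolding theta_rv_def by measurable

lemma measurable_obs_rv: "i < n \<Longrightarrow> obs_rv ts i \<in> borel_measurable (perm_gauss_space n)"
  using measurable_perm_gauss_snd[of i n] unfolding obs_rv_def by measurable

definition obs_vec :: "nat \<Rightarrow> (nat \<Rightarrow> real) \<Rightarrow> (nat \<Rightarrow> nat) \<times> (nat \<Rightarrow> real) \<Rightarrow> nat \<Rightarrow> real" where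
  "obs_vec n ts \<omega> = restrict (\<lambda>j. obs_rv ts j \<omega>) {..<n}"

lemma measurable_obs_vec[measurable]: "obs_vec n ts \<in> measurable (perm_gauss_space n) (\<Pi>\<^sub>M j\<in>{..<n}. borel)"
  unfolding obs_vec_def by (rule measurable_restrict) (simp add: measurable_obs_rv)

lemma nn_integral_perm_gauss:
  assumes [measurable]: "G \<in> borel_measurable (perm_gauss_space n)"
  shows "(\<integral>\<^sup>+\<omega>. G \<omega> \<partial>perm_gauss_space n)
       = (\<Sum>p\<in>{p. p permutes {..<n}}. \<integral>\<^sup>+z. G (p, z) \<partial>(\<Pi>\<^sub>M i\<in>{..<n}. density lborel std_normal_density)) / ennreal (fact n)"
proof -
  interpret G: product_prob_space "\<lambda>i::nat. density lborel std_normal_density" "{..<n}"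
    unfolding product_prob_space_def product_prob_space_axioms_def product_sigma_finite_def
    by (auto intro!: prob_space_imp_sigma_finite prob_space_normal_density)
  have fin: "finite {p. p permutes {..<n}}" by (rule finite_permutations) simp
  have ne: "{p. p permutes {..<n}} \<noteq> {}" using permutes_id by blast
  have "(\<integral>\<^sup>+\<omega>. G \<omega> \<partial>perm_gauss_space n)
     = (\<integral>\<^sup>+p. \<integral>\<^sup>+z. G (p, z) \<partial>(\<Pi>\<^sub>M i\<in>{..<n}. density lborel std_normal_density) \<partial>measure_pmf (pmf_of_set {p. p permutes {..<n}}))"
    unfolding perm_gauss_space_def
    by (rule G.P.nn_integral_fst[symmetric]) (use assms in \<open>simp add: perm_gauss_space_def\<close>)
  also have "\<dots> = (\<Sum>p\<in>{p. p permutes {..<n}}. \<integral>\<^sup>+z. G (p, z) \<partial>(\<Pi>\<^sub>M i\<in>{..<n}. density lborel std_normal_density)) / ennreal (fact n)"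
    by (subst nn_integral_pmf_of_set[OF ne fin]) (simp add: card_permutations ennreal_of_nat_eq_real_of_nat)
  finally show ?thesis .
qed

lemma nn_integral_obs_vec:
  assumes H: "\<And>p. p permutes {..<n} \<Longrightarrow> H p \<in> borel_measurable (\<Pi>\<^sub>M i\<in>{..<n}. borel)"
    and H': "(\<lambda>\<omega>. H (fst \<omega>) (obs_vec n ts \<omega>)) \<in> borel_measurable (perm_gauss_space n)"
  shows "(\<integral>\<^sup>+\<omega>. H (fst \<omega>) (obs_vec n ts \<omega>) \<partial>perm_gauss_space n)
       = (\<integral>\<^sup>+x. (\<Sum>p\<in>{p. p permutes {..<n}}. H p x * ennreal (\<Prod>i<n. normal_density (ts (p i)) 1 (x i))) / ennreal (fact n)
            \<partial>(\<Pi>\<^sub>M i\<in>{..<n}. lborel))"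
proof -
  have Hl: "H p \<in> borel_measurable (\<Pi>\<^sub>M i\<in>{..<n}. lborel)" if "p permutes {..<n}" for p
    using H[OF that] by (simp cong: measurable_cong_sets sets_PiM_cong)
  have N: "(\<lambda>x. ennreal (\<Prod>i<n. normal_density (ts (p i)) 1 (x i))) \<in> borel_measurable (\<Pi>\<^sub>M i\<in>{..<n}. lborel)" for p
    by measurable
  have "(\<integral>\<^sup>+\<omega>. H (fst \<omega>) (obs_vec n ts \<omega>) \<partial>perm_gauss_space n)
     = (\<Sum>p\<in>{p. p permutes {..<n}}. \<integral>\<^sup>+x. H p x * ennreal (\<Prod>i<n. normal_density (ts (p i)) 1 (x i))
            \<partial>(\<Pi>\<^sub>M i\<in>{..<n}. lborel)) / ennreal (fact n)"
    unfolding nn_integral_perm_gauss[OF H']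
    by (intro arg_cong2[where f = "(/)"] sum.cong refl)
       (simp add: obs_vec_def obs_rv_def nn_integral_PiM_normal_shift[OF H])
  also have "\<dots> = (\<integral>\<^sup>+x. (\<Sum>p\<in>{p. p permutes {..<n}}. H p x * ennreal (\<Prod>i<n. normal_density (ts (p i)) 1 (x i)))
            \<partial>(\<Pi>\<^sub>M i\<in>{..<n}. lborel)) / ennreal (fact n)"
    by (subst nn_integral_sum) (auto intro!: borel_measurable_times_ennreal Hl N)
  also have "\<dots> = (\<integral>\<^sup>+x. (\<Sum>p\<in>{p. p permutes {..<n}}. H p x * ennreal (\<Prod>i<n. normal_density (ts (p i)) 1 (x i))) / ennreal (fact n)
            \<partial>(\<Pi>\<^sub>M i\<in>{..<n}. lborel))"
    by (rule nn_integral_divide[symmetric]) (auto intro!: borel_measurable_sum borel_measurable_times_ennreal Hl N)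
  finally show ?thesis .
qed

lemma nn_integral_obs_rv:
  assumes i: "i < n" and H: "\<And>p. p permutes {..<n} \<Longrightarrow> H p \<in> borel_measurable borel"
    and H': "(\<lambda>\<omega>. H (fst \<omega>) (obs_rv ts i \<omega>)) \<in> borel_measurable (perm_gauss_space n)"
  shows "(\<integral>\<^sup>+\<omega>. H (fst \<omega>) (obs_rv ts i \<omega>) \<partial>perm_gauss_space n)
       = (\<integral>\<^sup>+x. (\<Sum>p\<in>{p. p permutes {..<n}}. H p x * ennreal (normal_density (ts (p i)) 1 x)) / ennreal (fact n) \<partial>lborel)"
proof -
  have "(\<integral>\<^sup>+\<omega>. H (fst \<omega>) (obs_rv ts i \<omega>) \<partial>perm_gauss_space n)
     = (\<Sum>p\<in>{p. p permutes {..<n}}. \<integral>\<^sup>+x. H p x * ennreal (normal_density (ts (p i)) 1 x) \<partial>lborel) / ennreal (fact n)"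
    unfolding nn_integral_perm_gauss[OF H']
    by (intro arg_cong2[where f = "(/)"] sum.cong refl)
       (simp add: obs_rv_def nn_integral_PiM_normal_shift_component[OF H i])
  also have "\<dots> = (\<integral>\<^sup>+x. (\<Sum>p\<in>{p. p permutes {..<n}}. H p x * ennreal (normal_density (ts (p i)) 1 x)) \<partial>lborel) / ennreal (fact n)"
    by (subst nn_integral_sum) (auto intro!: borel_measurable_times_ennreal H)
  also have "\<dots> = (\<integral>\<^sup>+x. (\<Sum>p\<in>{p. p permutes {..<n}}. H p x * ennreal (normal_density (ts (p i)) 1 x)) / ennreal (fact n) \<partial>lborel)"
    by (rule nn_integral_divide[symmetric]) (auto intro!: borel_measurable_sum borel_measurable_times_ennreal H)
  finally show ?thesis .
qed

text \<open>The permutation component lives in an uncountable discrete space, so joint measurability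
  is not automatic; it holds for functions that see only the values on \<open>{..<n}\<close>, since these
  form a countable set.\<close>

lemma measurable_perm_gauss_fst_dependent:
  assumes F: "\<And>p. F p \<in> borel_measurable (perm_gauss_space n)"
    and cong: "\<And>p \<omega>. F (\<lambda>i. if i < n then p i else 0) \<omega> = F p \<omega>"
  shows "(\<lambda>\<omega>. F (fst \<omega>) \<omega>) \<in> borel_measurable (perm_gauss_space n)"
proof -
  let ?I = "{p::nat \<Rightarrow> nat. \<forall>i\<ge>n. p i = 0}"
  let ?r = "\<lambda>p i. if i < n then p i else (0::nat)"
  have "inj_on (\<lambda>p. map p [0..<n]) ?I"
  proof (rule inj_onI, rule ext)
    fix p q :: "nat \<Rightarrow> nat" and i
    assume "p \<in> ?I" "q \<in> ?I" "map p [0..<n] = map q [0..<n]"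
    thus "p i = q i" by (cases "i < n") auto
  qed
  hence I: "countable ?I" by (rule countableI')
  have "(\<lambda>\<omega>. F (?r (fst \<omega>)) \<omega>) \<in> borel_measurable (perm_gauss_space n)"
  proof (rule measurable_compose_countable'[where f = F and g = "\<lambda>\<omega>. ?r (fst \<omega>)", OF _ _ I])
    show "(\<lambda>\<omega>. ?r (fst \<omega>)) \<in> measurable (perm_gauss_space n) (count_space ?I)"
      by (rule measurable_compose[OF measurable_perm_gauss_fst]) auto
  qed (rule F)
  thus ?thesis using cong by simp
qed

lemma AE_perm_gauss_permutes: "AE \<omega> in perm_gauss_space n. fst \<omega> permutes {..<n}"
proof -
  define S where "S = {\<omega> \<in> space (perm_gauss_space n). \<not> fst \<omega> permutes {..<n}}"
  have S[measurable]: "S \<in> sets (perm_gauss_space n)"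
    unfolding S_def using measurable_sets[OF measurable_perm_gauss_fst, of "{p. \<not> p permutes {..<n}}" n]
    by (auto simp: vimage_def Int_def conj_commute)
  have "emeasure (perm_gauss_space n) S = (\<integral>\<^sup>+\<omega>. indicator S \<omega> \<partial>perm_gauss_space n)" by simp
  also have "\<dots> = (\<Sum>p\<in>{p. p permutes {..<n}}.
      \<integral>\<^sup>+z. indicator S (p, z) \<partial>(\<Pi>\<^sub>M i\<in>{..<n}. density lborel std_normal_density)) / ennreal (fact n)"
    by (rule nn_integral_perm_gauss) simp
  also have "\<dots> = 0"
    by (simp add: S_def)
  finally have 0: "emeasure (perm_gauss_space n) S = 0" .
  show ?thesis by (rule AE_I[OF _ 0 S]) (auto simp: S_def)
qed

subsection \<open>Change of measure to the i.i.d. prior\<close>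

definition post_mean :: "nat \<Rightarrow> (nat \<Rightarrow> real) \<Rightarrow> (nat \<Rightarrow> real \<Rightarrow> real) \<Rightarrow> real \<Rightarrow> real" where
  "post_mean n ts g x =
     (\<Sum>k<n. normal_density (ts k) 1 x * g k x) / (\<Sum>k<n. normal_density (ts k) 1 x)"

lemma post_mean_bounds:
  assumes n: "0 < n" and g: "\<And>k. k < n \<Longrightarrow> lo \<le> g k x \<and> g k x \<le> hi"
  shows "lo \<le> post_mean n ts g x" and "post_mean n ts g x \<le> hi"
proof -
  have pos: "0 < (\<Sum>k<n. normal_density (ts k) 1 x)"
    using n by (intro sum_pos) (auto simp: normal_density_pos lessThan_empty_iff)
  have "(\<Sum>k<n. normal_density (ts k) 1 x * lo) \<le> (\<Sum>k<n. normal_density (ts k) 1 x * g k x)"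
    "(\<Sum>k<n. normal_density (ts k) 1 x * g k x) \<le> (\<Sum>k<n. normal_density (ts k) 1 x * hi)"
    using g by (auto intro!: sum_mono mult_left_mono)
  thus "lo \<le> post_mean n ts g x" "post_mean n ts g x \<le> hi"
    using pos unfolding sum_distrib_right[symmetric]
    by (simp_all add: post_mean_def le_divide_eq divide_le_eq mult.commute)
qed

lemma measurable_post_mean[measurable]:
  assumes [measurable]: "\<And>k. g k \<in> borel_measurable borel"
  shows "post_mean n ts g \<in> borel_measurable borel"
  unfolding post_mean_def by measurable

locale labelled_mixture =
  fixes n :: nat and ts :: "nat \<Rightarrow> real" and c :: "nat \<Rightarrow> 'b"
    and g :: "nat \<Rightarrow> real \<Rightarrow> real" and lo :: "real \<Rightarrow> real" and R :: real
    and f :: "nat \<Rightarrow> (nat \<Rightarrow> real) \<Rightarrow> real" and B lam :: real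
  assumes n: "2 \<le> n"
    and c: "\<And>k l. k < n \<Longrightarrow> l < n \<Longrightarrow> c k = c l \<Longrightarrow> \<bar>ts k - ts l\<bar> \<le> 1"
    and g[measurable]: "\<And>k. g k \<in> borel_measurable borel"
    and g_class: "\<And>k l x. k < n \<Longrightarrow> l < n \<Longrightarrow> c k = c l \<Longrightarrow> g k x = g l x"
    and g_range: "\<And>k x. k < n \<Longrightarrow> lo x \<le> g k x \<and> g k x \<le> lo x + R"
    and f[measurable]: "\<And>i. i < n \<Longrightarrow> f i \<in> borel_measurable (\<Pi>\<^sub>M j\<in>{..<n}. borel)"
    and f_bound: "\<And>i x. i < n \<Longrightarrow> \<bar>f i x\<bar> \<le> B"
    and lam: "0 < lam"
begin

abbreviation "P \<equiv> perm_gauss_space n"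
abbreviation "\<phi> k \<equiv> normal_density (ts k) 1"
abbreviation "perms \<equiv> {p. p permutes {..<n}}"

definition class_dens :: "nat \<Rightarrow> real \<Rightarrow> real" where
  "class_dens k x = (\<Sum>l\<in>{l\<in>{..<n}. c l = c k}. \<phi> l x)"

text \<open>Density of (class, observation) at position \<open>i\<close> once the labels at all positions above \<open>i\<close>
  are revealed, relative to the i.i.d. density.\<close>

definition ratio :: "nat \<Rightarrow> (nat \<Rightarrow> nat) \<Rightarrow> real \<Rightarrow> real" where
  "ratio i p x = ((\<Sum>j\<le>i. if c (p j) = c (p i) then \<phi> (p j) x else 0) / real (Suc i))
                   / (class_dens (p i) x / real n)"

definition tilt :: "nat \<Rightarrow> nat \<Rightarrow> (nat \<Rightarrow> real) \<Rightarrow> real" where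
  "tilt i k x = lam * (g k (x i) - post_mean n ts g (x i)) * f i x - (lam * f i x)\<^sup>2 * R\<^sup>2 / 8"

lemma phi_pos: "0 < \<phi> k x" by (simp add: normal_density_pos)

lemma class_dens_pos: "k < n \<Longrightarrow> 0 < class_dens k x"
  unfolding class_dens_def by (intro sum_pos) (auto simp: phi_pos)

lemma ratio_pos: "p permutes {..<n} \<Longrightarrow> i < n \<Longrightarrow> 0 < ratio i p x"
proof -
  assume p: "p permutes {..<n}" and i: "i < n"
  have "p i < n" using permutes_in_image[OF p, of i] i by simp
  moreover have "0 < (\<Sum>j\<le>i. if c (p j) = c (p i) then \<phi> (p j) x else 0)"
    by (rule sum_pos2[of _ i]) (auto simp: phi_pos)
  ultimately show "0 < ratio i p x" unfolding ratio_def
    using class_dens_pos[of "p i" x] n by simp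
qed

lemma measurable_ratio[measurable]: "ratio i p \<in> borel_measurable borel"
  unfolding ratio_def class_dens_def by measurable

lemma measurable_tilt[measurable]: "i < n \<Longrightarrow> tilt i k \<in> borel_measurable (\<Pi>\<^sub>M j\<in>{..<n}. borel)"
  unfolding tilt_def by measurable

lemma measurable_ratio_obs:
  assumes i: "i < n"
  shows "(\<lambda>\<omega>. ratio i (fst \<omega>) (obs_rv ts i \<omega>)) \<in> borel_measurable P"
proof (rule measurable_perm_gauss_fst_dependent[where F = "\<lambda>p \<omega>. ratio i p (obs_rv ts i \<omega>)"])
  fix p show "(\<lambda>\<omega>. ratio i p (obs_rv ts i \<omega>)) \<in> borel_measurable P"
    using measurable_obs_rv[OF i, of ts] by measurable
qed (use i in \<open>auto simp: ratio_def intro!: sum.cong\<close>)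

lemma measurable_tilt_obs:
  assumes i: "i < n"
  shows "(\<lambda>\<omega>. tilt i (fst \<omega> i) (obs_vec n ts \<omega>)) \<in> borel_measurable P"
proof (rule measurable_perm_gauss_fst_dependent[where F = "\<lambda>p \<omega>. tilt i (p i) (obs_vec n ts \<omega>)"])
  fix p show "(\<lambda>\<omega>. tilt i (p i) (obs_vec n ts \<omega>)) \<in> borel_measurable P"
    using measurable_tilt[OF i] by measurable
qed (use i in auto)

definition "num_classes = card (c ` {..<n})"

lemma nn_integral_ratio_le:
  assumes i: "i < n"
  shows "(\<integral>\<^sup>+\<omega>. ennreal (ratio i (fst \<omega>) (obs_rv ts i \<omega>)) \<partial>P)
           \<le> ennreal (3 * real num_classes / real (Suc i) + 1 + 1 / (real n - 1))"
proof -
  define u where "u b = ts (inv_into {..<n} c b)" for b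
  define bnd where "bnd x = ((\<Sum>b\<in>c ` {..<n}. 3 * normal_density (u b) (sqrt 2) x)
         + real i * (\<Sum>k<n. \<phi> k x) / (real n - 1)) / real (Suc i)" for x
  have le: "(\<Sum>p\<in>perms. \<phi> (p i) x * ratio i p x) \<le> fact n * bnd x" for x
  proof -
    have "(\<Sum>p\<in>perms. \<phi> (p i) x * ratio i p x)
       \<le> fact n * (((\<Sum>k<n. (\<phi> k x)\<^sup>2 / class_dens k x) + real i * (\<Sum>k<n. \<phi> k x) / (real n - 1)) / real (Suc i))"
      unfolding ratio_def class_dens_def
      by (rule sum_permutes_class_ratio_le[OF n i]) (rule phi_pos)
    also have "\<dots> \<le> fact n * bnd x"
      unfolding bnd_def class_dens_def
    proof (intro mult_left_mono divide_right_mono add_right_mono sum_square_over_class_le)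
      fix k assume k: "k \<in> {..<n}"
      have "inv_into {..<n} c (c k) \<in> {..<n}" "c (inv_into {..<n} c (c k)) = c k"
        using inv_into_into[of "c k" c "{..<n}"] f_inv_into_f[of "c k" c "{..<n}"] k by auto
      hence "\<bar>ts k - u (c k)\<bar> \<le> 1" using c[of k "inv_into {..<n} c (c k)"] k by (auto simp: u_def)
      thus "\<phi> k x \<le> 3 * normal_density (u (c k)) (sqrt 2) x" by (rule normal_density_le_wider)
    qed (auto simp: phi_pos)
    finally show ?thesis .
  qed
  have rnn: "0 \<le> ratio i p x" if "p \<in> perms" for p x using ratio_pos[of p i x] that i by simp
  have "(\<integral>\<^sup>+\<omega>. ennreal (ratio i (fst \<omega>) (obs_rv ts i \<omega>)) \<partial>P)
     = (\<integral>\<^sup>+x. (\<Sum>p\<in>perms. ennreal (ratio i p x) * ennreal (\<phi> (p i) x)) / ennreal (fact n) \<partial>lborel)"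
    by (rule nn_integral_obs_rv[OF i, where H = "\<lambda>p x. ennreal (ratio i p x)"])
       (use measurable_ratio_obs[OF i] in auto)
  also have "\<dots> \<le> (\<integral>\<^sup>+x. ennreal (bnd x) \<partial>lborel)"
  proof (rule nn_integral_mono)
    fix x
    have "(\<Sum>p\<in>perms. ennreal (ratio i p x) * ennreal (\<phi> (p i) x)) = (\<Sum>p\<in>perms. ennreal (\<phi> (p i) x * ratio i p x))"
      by (intro sum.cong refl) (use rnn in \<open>simp add: ennreal_mult[symmetric] mult.commute\<close>)
    also have "\<dots> = ennreal (\<Sum>p\<in>perms. \<phi> (p i) x * ratio i p x)"
      by (rule sum_ennreal) (use rnn in auto)
    finally have "(\<Sum>p\<in>perms. ennreal (ratio i p x) * ennreal (\<phi> (p i) x)) / ennreal (fact n)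
      = ennreal (\<Sum>p\<in>perms. \<phi> (p i) x * ratio i p x) / ennreal (fact n)" by (rule arg_cong)
    also have "\<dots> = ennreal ((\<Sum>p\<in>perms. \<phi> (p i) x * ratio i p x) / fact n)"
      by (rule divide_ennreal) (use rnn in \<open>auto intro!: sum_nonneg\<close>)
    also have "\<dots> \<le> ennreal (bnd x)"
      using le[of x] by (intro ennreal_leI) (simp add: divide_le_eq mult.commute)
    finally show "(\<Sum>p\<in>perms. ennreal (ratio i p x) * ennreal (\<phi> (p i) x)) / ennreal (fact n) \<le> ennreal (bnd x)" .
  qed
  also have "\<dots> = ennreal (integral\<^sup>L lborel bnd)"
    by (rule nn_integral_eq_integral)
       (use n in \<open>auto simp: bnd_def intro!: sum_nonneg add_nonneg_nonneg divide_nonneg_nonneg mult_nonneg_nonneg\<close>)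
  also have "integral\<^sup>L lborel bnd = (3 * real num_classes + real i * real n / (real n - 1)) / real (Suc i)"
    unfolding bnd_def num_classes_def by simp
  also have "\<dots> \<le> 3 * real num_classes / real (Suc i) + 1 + 1 / (real n - 1)"
  proof -
    have "real i * real n / (real n - 1) / real (Suc i) = (real i / real (Suc i)) * (real n / (real n - 1))" by simp
    also have "\<dots> \<le> 1 * (real n / (real n - 1))" using n by (intro mult_right_mono) auto
    also have "\<dots> = 1 + 1 / (real n - 1)" using n by (simp add: field_simps)
    finally show ?thesis by (simp add: add_divide_distrib)
  qed
  finally show ?thesis by (simp add: ennreal_leI)
qed

lemma nn_integral_exp_tilt_le:
  "(\<integral>\<^sup>+\<omega>. ennreal (exp (\<Sum>i<n. tilt i (fst \<omega> i) (obs_vec n ts \<omega>)) / (\<Prod>i<n. ratio i (fst \<omega>) (obs_vec n ts \<omega> i))) \<partial>P) \<le> 1"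
proof -
  define H where "H p x = exp (\<Sum>i<n. tilt i (p i) x) / (\<Prod>i<n. ratio i p (x i))" for p x
  define q where "q x = (\<Sum>k<n. \<phi> k x) / real n" for x
  have [measurable]: "H p \<in> borel_measurable (\<Pi>\<^sub>M j\<in>{..<n}. borel)" for p
    unfolding H_def by measurable
  have H': "(\<lambda>\<omega>. H (fst \<omega>) (obs_vec n ts \<omega>)) \<in> borel_measurable P"
  proof (rule measurable_perm_gauss_fst_dependent[where F = "\<lambda>p \<omega>. H p (obs_vec n ts \<omega>)"])
    fix p :: "nat \<Rightarrow> nat" and \<omega>
    have "ratio i (\<lambda>i. if i < n then p i else 0) y = ratio i p y" if "i < n" for i y
      using that by (auto simp: ratio_def intro!: sum.cong)
    thus "H (\<lambda>i. if i < n then p i else 0) (obs_vec n ts \<omega>) = H p (obs_vec n ts \<omega>)"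
      by (simp add: H_def)
  qed measurable
  have Hnn: "0 \<le> H p x" if "p \<in> perms" for p x
    unfolding H_def using ratio_pos that by (intro divide_nonneg_nonneg prod_nonneg) (auto intro: less_imp_le)
  have fact_real: "(\<Prod>i<m. real (Suc i)) = fact m" for m
    by (induction m) (simp_all add: mult.commute)
  have le: "(\<Sum>p\<in>perms. H p x * (\<Prod>i<n. \<phi> (p i) (x i))) \<le> fact n * (\<Prod>i<n. q (x i))" for x
  proof -
    define h where "h i S k = \<phi> k (x i) * (exp (tilt i k x) / real n) * (\<Sum>l\<in>{l\<in>{..<n}. c l = c k}. \<phi> l (x i))
             / (\<Sum>l\<in>{l\<in>S. c l = c k}. \<phi> l (x i))" for i S k
    have "H p x * (\<Prod>i<n. \<phi> (p i) (x i)) = fact n * (\<Prod>i<n. h i (p ` {..i}) (p i))" if p: "p \<in> perms" for p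
    proof -
      have eq: "(exp (tilt i (p i) x) / ratio i p (x i)) * \<phi> (p i) (x i) = real (Suc i) * h i (p ` {..i}) (p i)" if "i < n" for i
      proof -
        have "(\<Sum>l\<in>{l\<in>p ` {..i}. c l = c (p i)}. \<phi> l (x i)) = (\<Sum>l\<in>p ` {..i}. if c l = c (p i) then \<phi> l (x i) else 0)"
          by (rule sum.inter_filter) simp
        also have "\<dots> = (\<Sum>j\<le>i. if c (p j) = c (p i) then \<phi> (p j) (x i) else 0)"
          using p by (subst sum.reindex) (auto intro: inj_on_subset[OF permutes_inj])
        finally show ?thesis
          by (simp add: h_def ratio_def class_dens_def mult_ac)
      qed
      have "H p x * (\<Prod>i<n. \<phi> (p i) (x i)) = (\<Prod>i<n. (exp (tilt i (p i) x) / ratio i p (x i)) * \<phi> (p i) (x i))"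
        by (simp add: H_def exp_sum prod_dividef prod.distrib)
      also have "\<dots> = (\<Prod>i<n. real (Suc i) * h i (p ` {..i}) (p i))"
        by (rule prod.cong[OF refl], rule eq) simp
      also have "\<dots> = fact n * (\<Prod>i<n. h i (p ` {..i}) (p i))"
        by (simp only: prod.distrib fact_real)
      finally show ?thesis .
    qed
    hence "(\<Sum>p\<in>perms. H p x * (\<Prod>i<n. \<phi> (p i) (x i))) = (\<Sum>p\<in>perms. fact n * (\<Prod>i<n. h i (p ` {..i}) (p i)))"
      by (rule sum.cong[OF refl])
    also have "\<dots> = fact n * (\<Sum>p\<in>perms. \<Prod>i<n. h i (p ` {..i}) (p i))"
      by (simp only: sum_distrib_left)
    also have "(\<Sum>p\<in>perms. \<Prod>i<n. h i (p ` {..i}) (p i)) \<le> (\<Prod>i<n. q (x i))"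
      unfolding bij_from_lessThan[symmetric]
    proof (rule sum_bij_from_prod_le)
      fix i S k assume i: "i < n" and S: "S \<subseteq> {..<n}"
      show "0 \<le> h i S k" unfolding h_def by (auto intro!: sum_nonneg divide_nonneg_nonneg mult_nonneg_nonneg)
      have tilt_class: "tilt i k x = tilt i l x" if "k < n" "l < n" "c k = c l" for k l
        using g_class[OF that] by (simp add: tilt_def)
      have "(\<Sum>k\<in>S. h i S k) \<le> (\<Sum>k<n. \<phi> k (x i) * (exp (tilt i k x) / real n))"
        unfolding h_def
      proof (rule sum_class_share_le[OF _ S phi_pos])
        fix k l assume "k \<in> {..<n}" "l \<in> {..<n}" "c k = c l"
        hence "tilt i k x = tilt i l x" by (intro tilt_class) auto
        thus "exp (tilt i k x) / real n = exp (tilt i l x) / real n" by simp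
      qed auto
      also have "\<dots> = (\<Sum>k<n. \<phi> k (x i) * exp (tilt i k x)) / real n"
        by (simp add: sum_divide_distrib)
      also have "(\<Sum>k<n. \<phi> k (x i) * exp (tilt i k x))
         = (\<Sum>k<n. \<phi> k (x i) * exp ((lam * f i x) * (g k (x i) - post_mean n ts g (x i)))) / exp ((lam * f i x)\<^sup>2 * R\<^sup>2 / 8)"
        by (simp add: tilt_def exp_diff sum_divide_distrib mult_ac)
      also have "\<dots> \<le> (\<Sum>k<n. \<phi> k (x i)) * exp ((lam * f i x)\<^sup>2 * R\<^sup>2 / 8) / exp ((lam * f i x)\<^sup>2 * R\<^sup>2 / 8)"
        unfolding post_mean_def
        by (intro divide_right_mono hoeffding_weighted_mean[where lo = "lo (x i)"])
           (use n g_range phi_pos in \<open>auto simp: lessThan_empty_iff intro!: sum_pos\<close>)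
      finally show "(\<Sum>k\<in>S. h i S k) \<le> q (x i)"
        by (simp add: q_def divide_right_mono)
    qed (auto simp: q_def intro!: divide_nonneg_nonneg sum_nonneg)
    finally show ?thesis by simp
  qed
  have "(\<integral>\<^sup>+\<omega>. ennreal (H (fst \<omega>) (obs_vec n ts \<omega>)) \<partial>P)
     = (\<integral>\<^sup>+x. (\<Sum>p\<in>perms. ennreal (H p x) * ennreal (\<Prod>i<n. \<phi> (p i) (x i))) / ennreal (fact n) \<partial>(\<Pi>\<^sub>M i\<in>{..<n}. lborel))"
    by (rule nn_integral_obs_vec[where H = "\<lambda>p x. ennreal (H p x)"]) (use H' in auto)
  also have "\<dots> \<le> (\<integral>\<^sup>+x. (\<Prod>i\<in>{..<n}. ennreal (q (x i))) \<partial>(\<Pi>\<^sub>M i\<in>{..<n}. lborel))"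
  proof (rule nn_integral_mono)
    fix x :: "nat \<Rightarrow> real"
    have nn: "0 \<le> H p x * (\<Prod>i<n. \<phi> (p i) (x i))" if "p \<in> perms" for p
      using Hnn[OF that] by (intro mult_nonneg_nonneg prod_nonneg) auto
    have "(\<Sum>p\<in>perms. ennreal (H p x) * ennreal (\<Prod>i<n. \<phi> (p i) (x i))) = (\<Sum>p\<in>perms. ennreal (H p x * (\<Prod>i<n. \<phi> (p i) (x i))))"
      by (intro sum.cong refl) (use Hnn in \<open>simp add: ennreal_mult prod_nonneg\<close>)
    also have "\<dots> = ennreal (\<Sum>p\<in>perms. H p x * (\<Prod>i<n. \<phi> (p i) (x i)))"
      by (rule sum_ennreal) (use nn in auto)
    finally have "(\<Sum>p\<in>perms. ennreal (H p x) * ennreal (\<Prod>i<n. \<phi> (p i) (x i))) / ennreal (fact n)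
       = ennreal (\<Sum>p\<in>perms. H p x * (\<Prod>i<n. \<phi> (p i) (x i))) / ennreal (fact n)" by (rule arg_cong)
    also have "\<dots> = ennreal ((\<Sum>p\<in>perms. H p x * (\<Prod>i<n. \<phi> (p i) (x i))) / fact n)"
      by (rule divide_ennreal) (use nn in \<open>auto intro!: sum_nonneg\<close>)
    also have "\<dots> \<le> ennreal (\<Prod>i<n. q (x i))"
      using le[of x] by (intro ennreal_leI) (simp add: divide_le_eq mult.commute)
    finally show "(\<Sum>p\<in>perms. ennreal (H p x) * ennreal (\<Prod>i<n. \<phi> (p i) (x i))) / ennreal (fact n)
        \<le> (\<Prod>i\<in>{..<n}. ennreal (q (x i)))"
      by (subst prod_ennreal) (auto simp: q_def intro!: divide_nonneg_nonneg sum_nonneg)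
  qed
  also have "\<dots> = (\<Prod>i\<in>{..<n}. \<integral>\<^sup>+x. ennreal (q x) \<partial>lborel)"
  proof -
    interpret L: product_sigma_finite "\<lambda>i::nat. lborel :: real measure"
      unfolding product_sigma_finite_def using sigma_finite_lborel by auto
    show ?thesis by (rule L.product_nn_integral_prod) (auto simp: q_def)
  qed
  also have "(\<integral>\<^sup>+x. ennreal (q x) \<partial>lborel) = ennreal (integral\<^sup>L lborel q)"
    by (rule nn_integral_eq_integral) (auto simp: q_def intro!: divide_nonneg_nonneg sum_nonneg)
  also have "integral\<^sup>L lborel q = 1" unfolding q_def using n by simp
  finally show ?thesis by (simp add: H_def)
qed

lemma obs_vec_nth: "i < n \<Longrightarrow> obs_vec n ts \<omega> i = obs_rv ts i \<omega>"
  by (simp add: obs_vec_def)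

lemma integral_tilt_le:
  shows "integrable P (\<lambda>\<omega>. \<Sum>i<n. tilt i (fst \<omega> i) (obs_vec n ts \<omega>))" (is ?int)
    and "(\<integral>\<omega>. (\<Sum>i<n. tilt i (fst \<omega> i) (obs_vec n ts \<omega>)) \<partial>P) \<le> 3 * real num_classes * (1 + ln (real n)) + 2"
proof -
  interpret P: prob_space P by (rule prob_space_perm_gauss)
  let ?y = "\<lambda>\<omega>. \<Sum>i<n. tilt i (fst \<omega> i) (obs_vec n ts \<omega>)"
  let ?v = "\<lambda>i \<omega>. ratio i (fst \<omega>) (obs_vec n ts \<omega> i)"
  let ?U = "\<lambda>\<omega>. exp (?y \<omega>) / (\<Prod>i<n. ?v i \<omega>)"
  have ym[measurable]: "?y \<in> borel_measurable P"
    by (intro borel_measurable_sum measurable_tilt_obs) auto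
  have vm: "?v i \<in> borel_measurable P" if "i < n" for i
    using measurable_ratio_obs[OF that] by (simp add: obs_vec_nth that)
  have Um[measurable]: "?U \<in> borel_measurable P"
    by (intro borel_measurable_divide borel_measurable_prod borel_measurable_exp[THEN measurable_compose[OF ym]] vm) auto
  have vnn: "AE \<omega> in P. 0 \<le> ?v i \<omega>" if "i < n" for i
    using AE_perm_gauss_permutes by eventually_elim (use ratio_pos that in \<open>auto intro: less_imp_le\<close>)
  have Unn: "AE \<omega> in P. 0 \<le> ?U \<omega>"
    using AE_perm_gauss_permutes
    by eventually_elim (auto intro!: divide_nonneg_nonneg prod_nonneg less_imp_le[OF ratio_pos])
  have vint: "integrable P (?v i)" "(\<integral>\<omega>. ?v i \<omega> \<partial>P) \<le> 3 * real num_classes / real (Suc i) + 1 + 1 / (real n - 1)"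
    if i: "i < n" for i
  proof -
    have le: "(\<integral>\<^sup>+\<omega>. ennreal (?v i \<omega>) \<partial>P) \<le> ennreal (3 * real num_classes / real (Suc i) + 1 + 1 / (real n - 1))"
      using nn_integral_ratio_le[OF i] by (simp add: obs_vec_nth i)
    also have "\<dots> < \<infinity>" by simp
    finally show int: "integrable P (?v i)"
      by (intro integrableI_nonneg vm vnn i)
    show "(\<integral>\<omega>. ?v i \<omega> \<partial>P) \<le> 3 * real num_classes / real (Suc i) + 1 + 1 / (real n - 1)"
      using le n unfolding nn_integral_eq_integral[OF int vnn[OF i]]
      by (subst (asm) ennreal_le_iff) auto
  qed
  have Ule: "(\<integral>\<^sup>+\<omega>. ennreal (?U \<omega>) \<partial>P) \<le> ennreal 1" using nn_integral_exp_tilt_le by simp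
  also have "\<dots> < \<infinity>" by simp
  finally have Uint: "integrable P ?U" by (intro integrableI_nonneg Um Unn)
  have U1: "(\<integral>\<omega>. ?U \<omega> \<partial>P) \<le> 1"
    using Ule unfolding nn_integral_eq_integral[OF Uint Unn] by (subst (asm) ennreal_le_iff) auto
  have R0: "0 \<le> R" using g_range[of 0 0] n by auto
  show yint: ?int
  proof (rule P.integrable_const_bound[OF _ ym])
    show "AE \<omega> in P. norm (?y \<omega>) \<le> (\<Sum>i<n. lam * R * B + lam\<^sup>2 * B\<^sup>2 * R\<^sup>2 / 8)"
      using AE_perm_gauss_permutes
    proof eventually_elim
      case (elim \<omega>)
      have "\<bar>tilt i (fst \<omega> i) x\<bar> \<le> lam * R * B + lam\<^sup>2 * B\<^sup>2 * R\<^sup>2 / 8" if i: "i < n" for i x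
      proof -
        have k: "fst \<omega> i < n" using permutes_in_image[OF elim, of i] i by simp
        have "\<bar>g (fst \<omega> i) (x i) - post_mean n ts g (x i)\<bar> \<le> R"
          using g_range[OF k, of "x i"] n
          post_mean_bounds[of n "lo (x i)" g "x i" "lo (x i) + R" ts] g_range by force
        hence 1: "\<bar>lam * (g (fst \<omega> i) (x i) - post_mean n ts g (x i)) * f i x\<bar> \<le> lam * R * B"
          unfolding abs_mult using lam f_bound[OF i, of x] R0 by (intro mult_mono) auto
        have "(f i x)\<^sup>2 \<le> B\<^sup>2" using f_bound[OF i, of x] by (metis abs_ge_zero power2_abs power_mono)
        hence "lam\<^sup>2 * (f i x)\<^sup>2 * R\<^sup>2 / 8 \<le> lam\<^sup>2 * B\<^sup>2 * R\<^sup>2 / 8"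
          by (intro divide_right_mono mult_right_mono mult_left_mono) auto
        moreover have "0 \<le> lam\<^sup>2 * (f i x)\<^sup>2 * R\<^sup>2 / 8" by simp
        ultimately show ?thesis using 1 unfolding tilt_def power_mult_distrib by linarith
      qed
      thus ?case unfolding real_norm_def by (intro order_trans[OF sum_abs] sum_mono) auto
    qed
  qed
  txt \<open>This step replaces the chain rule for relative entropy and the Gibbs variational
    principle by \<open>ln t \<le> t - 1\<close>.\<close>
  have pw: "AE \<omega> in P. ?y \<omega> \<le> (?U \<omega> - 1) + (\<Sum>i<n. ?v i \<omega> - 1)"
    using AE_perm_gauss_permutes
  proof eventually_elim
    case (elim \<omega>)
    have v: "0 < ?v i \<omega>" if "i < n" for i using ratio_pos[OF elim that] .
    have v0: "?v i \<omega> \<noteq> 0" if "i < n" for i using v[OF that] by simp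
    have vp: "0 < (\<Prod>i<n. ?v i \<omega>)" by (intro prod_pos) (use v in auto)
    have "Y = ln (exp Y / Q) + ln Q" if "0 < Q" for Y Q :: real
      using that by (simp add: ln_div)
    from this[OF vp] have "?y \<omega> = ln (?U \<omega>) + ln (\<Prod>i<n. ?v i \<omega>)" .
    also have "ln (\<Prod>i<n. ?v i \<omega>) = (\<Sum>i<n. ln (?v i \<omega>))"
      by (rule ln_prod) (use v0 in auto)
    also have "\<dots> \<le> (\<Sum>i<n. ?v i \<omega> - 1)"
      by (intro sum_mono ln_le_minus_one v) auto
    also have "ln (?U \<omega>) \<le> ?U \<omega> - 1" using vp by (intro ln_le_minus_one) auto
    finally show ?case by simp
  qed
  have "(\<integral>\<omega>. ?y \<omega> \<partial>P) \<le> (\<integral>\<omega>. (?U \<omega> - 1) + (\<Sum>i<n. ?v i \<omega> - 1) \<partial>P)"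
    by (rule integral_mono_AE[OF yint _ pw])
       (intro Bochner_Integration.integrable_add Bochner_Integration.integrable_diff
          Bochner_Integration.integrable_sum P.integrable_const Uint vint, simp)
  also have "\<dots> = ((\<integral>\<omega>. ?U \<omega> \<partial>P) - 1) + (\<Sum>i<n. (\<integral>\<omega>. ?v i \<omega> \<partial>P) - 1)"
    using Uint vint(1)
    by (subst Bochner_Integration.integral_add Bochner_Integration.integral_diff
          Bochner_Integration.integral_sum; auto simp: P.prob_space)+
  also have "\<dots> \<le> 0 + (\<Sum>i<n. 3 * real num_classes * (1 / real (Suc i)) + 1 / (real n - 1))"
    using U1 vint(2) by (intro add_mono sum_mono) (auto simp: algebra_simps)
  also have "\<dots> = 3 * real num_classes * (\<Sum>i<n. 1 / real (Suc i)) + real n / (real n - 1)"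
    by (simp add: sum.distrib sum_distrib_left)
  also have "\<dots> \<le> 3 * real num_classes * (1 + ln (real n)) + 2"
    using n by (intro add_mono mult_left_mono sum_inverse_Suc_le_ln) (auto simp: field_simps)
  finally show "(\<integral>\<omega>. ?y \<omega> \<partial>P) \<le> 3 * real num_classes * (1 + ln (real n)) + 2" .
qed

end

lemma label_deviation_bound:
  fixes n :: nat and ts :: "nat \<Rightarrow> real" and c :: "nat \<Rightarrow> 'b"
    and g :: "nat \<Rightarrow> real \<Rightarrow> real" and lo :: "real \<Rightarrow> real" and R a B :: real
    and f :: "nat \<Rightarrow> (nat \<Rightarrow> real) \<Rightarrow> real"
  assumes n: "2 \<le> n"
    and c: "\<And>k l. k < n \<Longrightarrow> l < n \<Longrightarrow> c k = c l \<Longrightarrow> \<bar>ts k - ts l\<bar> \<le> 1"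
    and g: "\<And>k. g k \<in> borel_measurable borel"
    and g_class: "\<And>k l x. k < n \<Longrightarrow> l < n \<Longrightarrow> c k = c l \<Longrightarrow> g k x = g l x"
    and g_range: "\<And>k x. k < n \<Longrightarrow> lo x \<le> g k x \<and> g k x \<le> lo x + R"
    and f[measurable]: "\<And>i. i < n \<Longrightarrow> f i \<in> borel_measurable (\<Pi>\<^sub>M j\<in>{..<n}. borel)"
    and f_bound: "\<And>i x. i < n \<Longrightarrow> \<bar>f i x\<bar> \<le> B"
    and a: "0 < a" and R: "0 < R"
  shows "integrable (perm_gauss_space n)
           (\<lambda>\<omega>. \<Sum>i<n. (g (fst \<omega> i) (obs_rv ts i \<omega>) - post_mean n ts g (obs_rv ts i \<omega>)) * f i (obs_vec n ts \<omega>))"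
    and "(\<integral>\<omega>. (\<Sum>i<n. (g (fst \<omega> i) (obs_rv ts i \<omega>) - post_mean n ts g (obs_rv ts i \<omega>)) * f i (obs_vec n ts \<omega>))
             \<partial>perm_gauss_space n)
         \<le> a * (\<integral>\<omega>. (\<Sum>i<n. (f i (obs_vec n ts \<omega>))\<^sup>2) \<partial>perm_gauss_space n)
             + R\<^sup>2 / (8 * a) * (3 * real (card (c ` {..<n})) * (1 + ln (real n)) + 2)"
proof -
  define lam where "lam = 8 * a / R\<^sup>2"
  have lam: "0 < lam" using a R by (simp add: lam_def)
  interpret labelled_mixture n ts c g lo R f B lam
    by (rule labelled_mixture.intro[OF n c g g_class g_range f f_bound lam])
  interpret P: prob_space P by (rule prob_space_perm_gauss)
  define S1 where "S1 \<omega> = (\<Sum>i<n. (g (fst \<omega> i) (obs_rv ts i \<omega>) - post_mean n ts g (obs_rv ts i \<omega>)) * f i (obs_vec n ts \<omega>))" for \<omega>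
  define S2 where "S2 \<omega> = (\<Sum>i<n. (f i (obs_vec n ts \<omega>))\<^sup>2)" for \<omega>
  define T where "T \<omega> = (\<Sum>i<n. tilt i (fst \<omega> i) (obs_vec n ts \<omega>))" for \<omega>
  have S2: "integrable P S2"
  proof (rule P.integrable_const_bound)
    have "(f i x)\<^sup>2 \<le> B\<^sup>2" if "i < n" for i x
      using f_bound[OF that, of x] by (metis abs_ge_zero power2_abs power_mono)
    hence "S2 \<omega> \<le> (\<Sum>i<n. B\<^sup>2)" for \<omega> unfolding S2_def by (intro sum_mono) auto
    moreover have "0 \<le> S2 \<omega>" for \<omega> unfolding S2_def by (intro sum_nonneg) auto
    ultimately show "AE \<omega> in P. norm (S2 \<omega>) \<le> (\<Sum>i<n. B\<^sup>2)" by (intro AE_I2) auto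
    show "S2 \<in> borel_measurable P" unfolding S2_def by measurable
  qed
  have T: "integrable P T" "(\<integral>\<omega>. T \<omega> \<partial>P) \<le> 3 * real num_classes * (1 + ln (real n)) + 2"
    unfolding T_def by (rule integral_tilt_le)+
  have quad: "(lam * y)\<^sup>2 * R\<^sup>2 / 8 = lam * a * y\<^sup>2" for y
    using R by (simp add: lam_def power2_eq_square field_simps)
  have TS: "T \<omega> = lam * S1 \<omega> - lam * a * S2 \<omega>" for \<omega>
    unfolding T_def S1_def S2_def tilt_def quad
    by (simp add: sum_subtractf sum_distrib_left obs_vec_nth mult.assoc)
  have S1: "S1 = (\<lambda>\<omega>. T \<omega> / lam + a * S2 \<omega>)"
    using lam by (simp add: fun_eq_iff TS field_simps)
  have intS1: "integrable P S1" unfolding S1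
    by (intro Bochner_Integration.integrable_add integrable_divide integrable_mult_right T S2)
  thus "integrable P
           (\<lambda>\<omega>. \<Sum>i<n. (g (fst \<omega> i) (obs_rv ts i \<omega>) - post_mean n ts g (obs_rv ts i \<omega>)) * f i (obs_vec n ts \<omega>))"
    unfolding S1_def .
  have "(\<integral>\<omega>. S1 \<omega> \<partial>P) = (\<integral>\<omega>. T \<omega> \<partial>P) / lam + a * (\<integral>\<omega>. S2 \<omega> \<partial>P)"
    unfolding S1 using T S2 by simp
  also have "\<dots> \<le> (3 * real num_classes * (1 + ln (real n)) + 2) / lam + a * (\<integral>\<omega>. S2 \<omega> \<partial>P)"
    using T(2) lam by (intro add_right_mono divide_right_mono) auto
  also have "\<dots> = a * (\<integral>\<omega>. S2 \<omega> \<partial>P) + R\<^sup>2 / (8 * a) * (3 * real (card (c ` {..<n})) * (1 + ln (real n)) + 2)"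
    by (simp add: lam_def num_classes_def)
  finally show "(\<integral>\<omega>. (\<Sum>i<n. (g (fst \<omega> i) (obs_rv ts i \<omega>) - post_mean n ts g (obs_rv ts i \<omega>)) * f i (obs_vec n ts \<omega>)) \<partial>P)
         \<le> a * (\<integral>\<omega>. (\<Sum>i<n. (f i (obs_vec n ts \<omega>))\<^sup>2) \<partial>P)
             + R\<^sup>2 / (8 * a) * (3 * real (card (c ` {..<n})) * (1 + ln (real n)) + 2)"
    unfolding S1_def S2_def .
qed

subsection \<open>Conditional expectations\<close>

lemma (in prob_space) real_cond_exp_pythagoras:
  assumes sub: "subalgebra M G" and t[measurable]: "t \<in> borel_measurable M"
    and tb: "AE x in M. \<bar>t x\<bar> \<le> b"
    and h: "h \<in> borel_measurable G" and h2: "integrable M (\<lambda>x. (h x)\<^sup>2)"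
  shows "integrable M (\<lambda>x. (t x - real_cond_exp M G t x)\<^sup>2)"
    and "integrable M (\<lambda>x. (real_cond_exp M G t x - h x)\<^sup>2)"
    and "integrable M (\<lambda>x. (t x - h x)\<^sup>2)"
    and "(\<integral>x. (t x - h x)\<^sup>2 \<partial>M) = (\<integral>x. (t x - real_cond_exp M G t x)\<^sup>2 \<partial>M)
            + (\<integral>x. (real_cond_exp M G t x - h x)\<^sup>2 \<partial>M)"
    and "AE x in M. \<bar>real_cond_exp M G t x\<bar> \<le> b"
proof -
  interpret finite_measure_subalgebra M G by unfold_locales (rule sub)
  let ?s = "real_cond_exp M G t"
  have hM[measurable]: "h \<in> borel_measurable M" by (rule measurable_from_subalg[OF sub h])
  have sM[measurable]: "?s \<in> borel_measurable M" by (rule borel_measurable_cond_exp2)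
  have tint: "integrable M t" by (rule integrable_const_bound[where B = b]) (use tb in auto)
  have "AE x in M. ?s x \<le> b" by (rule real_cond_exp_le_c[OF tint]) (use tb in auto)
  moreover have "AE x in M. - b \<le> ?s x" by (rule real_cond_exp_ge_c[OF tint]) (use tb in auto)
  ultimately show sb: "AE x in M. \<bar>?s x\<bar> \<le> b" by eventually_elim auto
  have hint: "integrable M h" by (rule square_integrable_imp_integrable[OF hM h2])
  have prod_int: "integrable M (\<lambda>x. u x * w x)" if "AE x in M. \<bar>u x\<bar> \<le> b" "integrable M w" "u \<in> borel_measurable M" for u w :: "'a \<Rightarrow> real"
  proof (rule Bochner_Integration.integrable_bound[of M "\<lambda>x. b * w x"])
    show "AE x in M. norm (u x * w x) \<le> norm (b * w x)"
      using that(1) by eventually_elim (auto simp: abs_mult intro!: mult_right_mono)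
    show "(\<lambda>x. u x * w x) \<in> borel_measurable M" using that(2,3) by measurable
  qed (use that in auto)
  have sint: "integrable M ?s" using tint by (rule real_cond_exp_int(1))
  have i: "integrable M (\<lambda>x. t x * t x)" "integrable M (\<lambda>x. t x * ?s x)" "integrable M (\<lambda>x. ?s x * ?s x)"
     "integrable M (\<lambda>x. t x * h x)" "integrable M (\<lambda>x. ?s x * h x)" "integrable M (\<lambda>x. h x * h x)"
    using prod_int[OF tb tint] prod_int[OF tb sint] prod_int[OF sb sint] prod_int[OF tb hint] prod_int[OF sb hint] h2
    by (auto simp: power2_eq_square)
  have sq: "integrable M (\<lambda>x. (u x - w x)\<^sup>2)"
    if "integrable M (\<lambda>x. u x * u x)" "integrable M (\<lambda>x. u x * w x)" "integrable M (\<lambda>x. w x * w x)" for u w :: "'a \<Rightarrow> real"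
  proof -
    have "(\<lambda>x. (u x - w x)\<^sup>2) = (\<lambda>x. u x * u x - 2 * (u x * w x) + w x * w x)"
      by (simp add: fun_eq_iff power2_eq_square algebra_simps)
    thus ?thesis using that by simp
  qed
  show 1: "integrable M (\<lambda>x. (t x - ?s x)\<^sup>2)" by (rule sq[OF i(1-3)])
  show 2: "integrable M (\<lambda>x. (?s x - h x)\<^sup>2)"
    by (rule sq[OF i(3,5,6)])
  show "integrable M (\<lambda>x. (t x - h x)\<^sup>2)"
    by (rule sq[OF i(1,4,6)])
  have cross: "(\<integral>x. (?s x - h x) * ?s x \<partial>M) = (\<integral>x. (?s x - h x) * t x \<partial>M)"
  proof (rule real_cond_exp_intg(2))
    show "integrable M (\<lambda>x. (?s x - h x) * t x)" using i(2,4) by (simp add: algebra_simps)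
    show "(\<lambda>x. ?s x - h x) \<in> borel_measurable G"
      using h by (intro borel_measurable_diff borel_measurable_cond_exp)
  qed (rule t)
  have ci: "integrable M (\<lambda>x. (?s x - h x) * t x)" "integrable M (\<lambda>x. (?s x - h x) * ?s x)"
    using i(2-5) by (simp_all add: algebra_simps)
  have "(\<integral>x. (t x - h x)\<^sup>2 \<partial>M) = (\<integral>x. (t x - ?s x)\<^sup>2 + (?s x - h x)\<^sup>2 + 2 * ((?s x - h x) * t x - (?s x - h x) * ?s x) \<partial>M)"
    by (intro Bochner_Integration.integral_cong refl) (simp add: power2_eq_square algebra_simps)
  also have "\<dots> = (\<integral>x. (t x - ?s x)\<^sup>2 \<partial>M) + (\<integral>x. (?s x - h x)\<^sup>2 \<partial>M)"
    using 1 2 ci cross by simp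
  finally show "(\<integral>x. (t x - h x)\<^sup>2 \<partial>M) = (\<integral>x. (t x - ?s x)\<^sup>2 \<partial>M) + (\<integral>x. (?s x - h x)\<^sup>2 \<partial>M)" .
qed

lemma (in prob_space) real_cond_exp_nested_diff_le:
  assumes sub: "subalgebra M G" and sub': "subalgebra G F" and t[measurable]: "t \<in> borel_measurable M"
    and tb: "AE x in M. \<bar>t x\<bar> \<le> b"
    and h: "h \<in> borel_measurable F" and h2: "integrable M (\<lambda>x. (h x)\<^sup>2)"
  shows "integrable M (\<lambda>x. (real_cond_exp M F t x - real_cond_exp M G t x)\<^sup>2)"
    and "(\<integral>x. (real_cond_exp M F t x - real_cond_exp M G t x)\<^sup>2 \<partial>M) \<le> (\<integral>x. (real_cond_exp M G t x - h x)\<^sup>2 \<partial>M)"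
    and "(\<integral>x. (real_cond_exp M F t x - real_cond_exp M G t x)\<^sup>2 \<partial>M) \<le> (\<integral>x. (t x - h x)\<^sup>2 \<partial>M)"
proof -
  let ?s = "real_cond_exp M G t"
  have subF: "subalgebra M F" using sub sub' by (auto simp: subalgebra_def)
  interpret F: finite_measure_subalgebra M F by unfold_locales (rule subF)
  have hG: "h \<in> borel_measurable G" by (rule measurable_from_subalg[OF sub' h])
  note pG = real_cond_exp_pythagoras[OF sub t tb hG h2]
  have sM[measurable]: "?s \<in> borel_measurable M" by (rule borel_measurable_cond_exp2)
  note pF = real_cond_exp_pythagoras[OF subF sM pG(5) h h2]
  have tint: "integrable M t" by (rule integrable_const_bound[where B = b]) (use tb in auto)
  have ae: "AE x in M. (real_cond_exp M F t x - ?s x)\<^sup>2 = (?s x - real_cond_exp M F ?s x)\<^sup>2"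
    using F.real_cond_exp_nested_subalg[OF sub sub' tint]
    by eventually_elim (simp add: power2_commute)
  have [measurable]: "real_cond_exp M F t \<in> borel_measurable M" "real_cond_exp M F ?s \<in> borel_measurable M"
    by (rule borel_measurable_cond_exp2)+
  show "integrable M (\<lambda>x. (real_cond_exp M F t x - ?s x)\<^sup>2)"
    using pF(1) by (subst integrable_cong_AE[OF _ _ ae]) auto
  have eq: "(\<integral>x. (real_cond_exp M F t x - ?s x)\<^sup>2 \<partial>M) = (\<integral>x. (?s x - real_cond_exp M F ?s x)\<^sup>2 \<partial>M)"
    by (rule integral_cong_AE[OF _ _ ae]) auto
  have nn: "0 \<le> (\<integral>x. (real_cond_exp M F ?s x - h x)\<^sup>2 \<partial>M)" "0 \<le> (\<integral>x. (t x - ?s x)\<^sup>2 \<partial>M)"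
    by (rule integral_nonneg_AE, simp)+
  show 2: "(\<integral>x. (real_cond_exp M F t x - ?s x)\<^sup>2 \<partial>M) \<le> (\<integral>x. (?s x - h x)\<^sup>2 \<partial>M)"
    using pF(4) eq nn by linarith
  show "(\<integral>x. (real_cond_exp M F t x - ?s x)\<^sup>2 \<partial>M) \<le> (\<integral>x. (t x - h x)\<^sup>2 \<partial>M)"
    using 2 pG(4) nn by linarith
qed

definition obs_algebra :: "nat \<Rightarrow> (nat \<Rightarrow> real) \<Rightarrow> ((nat \<Rightarrow> nat) \<times> (nat \<Rightarrow> real)) measure" where
  "obs_algebra n ts = vimage_algebra (space (perm_gauss_space n)) (obs_vec n ts) (\<Pi>\<^sub>M j\<in>{..<n}. borel)"

definition coord_algebra :: "nat \<Rightarrow> (nat \<Rightarrow> real) \<Rightarrow> nat \<Rightarrow> ((nat \<Rightarrow> nat) \<times> (nat \<Rightarrow> real)) measure" where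
  "coord_algebra n ts i = vimage_algebra (space (perm_gauss_space n)) (obs_rv ts i) borel"

lemma pi_est_eq: "pi_est n ts i = real_cond_exp (perm_gauss_space n) (obs_algebra n ts) (theta_rv ts i)"
  by (simp add: pi_est_def obs_algebra_def obs_vec_def[abs_def])

lemma sep_est_eq: "sep_est n ts i = real_cond_exp (perm_gauss_space n) (coord_algebra n ts i) (theta_rv ts i)"
  by (simp add: sep_est_def coord_algebra_def)

lemma space_obs_algebra: "space (obs_algebra n ts) = space (perm_gauss_space n)"
  by (simp add: obs_algebra_def)

lemma measurable_obs_algebra: "obs_vec n ts \<in> measurable (obs_algebra n ts) (\<Pi>\<^sub>M j\<in>{..<n}. borel)"
  unfolding obs_algebra_def
  by (rule measurable_vimage_algebra1) (auto intro: measurable_space[OF measurable_obs_vec])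

lemma measurable_coord_algebra: "obs_rv ts i \<in> borel_measurable (coord_algebra n ts i)"
  unfolding coord_algebra_def by (rule measurable_vimage_algebra1) auto

lemma subalgebra_obs: "subalgebra (perm_gauss_space n) (obs_algebra n ts)"
  unfolding subalgebra_def space_obs_algebra unfolding obs_algebra_def
  by (intro conjI refl sets_image_in_sets measurable_obs_vec)

lemma subalgebra_coord:
  assumes i: "i < n"
  shows "subalgebra (obs_algebra n ts) (coord_algebra n ts i)"
proof -
  have "(\<lambda>\<omega>. obs_vec n ts \<omega> i) \<in> borel_measurable (obs_algebra n ts)"
    by (rule measurable_compose[OF measurable_obs_algebra measurable_component_singleton]) (use i in auto)
  hence "obs_rv ts i \<in> borel_measurable (obs_algebra n ts)"
    using i by (simp add: obs_vec_def)
  hence "sets (coord_algebra n ts i) \<subseteq> sets (obs_algebra n ts)"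
    unfolding coord_algebra_def by (intro sets_image_in_sets space_obs_algebra)
  thus ?thesis by (simp add: subalgebra_def coord_algebra_def obs_algebra_def)
qed

definition likelihood :: "nat \<Rightarrow> (nat \<Rightarrow> real) \<Rightarrow> (nat \<Rightarrow> nat) \<Rightarrow> (nat \<Rightarrow> real) \<Rightarrow> real" where
  "likelihood n ts p x = (\<Prod>j<n. normal_density (ts (p j)) 1 (x j))"

definition oracle_mean :: "nat \<Rightarrow> (nat \<Rightarrow> real) \<Rightarrow> nat \<Rightarrow> (nat \<Rightarrow> real) \<Rightarrow> real" where
  "oracle_mean n ts i x = (\<Sum>p\<in>{p. p permutes {..<n}}. ts (p i) * likelihood n ts p x)
                            / (\<Sum>p\<in>{p. p permutes {..<n}}. likelihood n ts p x)"

lemma likelihood_pos: "0 < likelihood n ts p x"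
  unfolding likelihood_def by (intro prod_pos) (simp add: normal_density_pos)

lemma sum_likelihood_pos: "0 < (\<Sum>p\<in>{p. p permutes {..<n}}. likelihood n ts p x)"
  by (rule sum_pos) (auto simp: likelihood_pos finite_permutations intro: exI[of _ id] permutes_id)

lemma measurable_oracle_mean[measurable]: "oracle_mean n ts i \<in> borel_measurable (\<Pi>\<^sub>M j\<in>{..<n}. borel)"
  unfolding oracle_mean_def likelihood_def by measurable

lemma abs_oracle_mean_le:
  assumes ts: "\<And>k. k < n \<Longrightarrow> \<bar>ts k\<bar> \<le> b" and i: "i < n"
  shows "\<bar>oracle_mean n ts i x\<bar> \<le> b"
proof -
  let ?P = "{p. p permutes {..<n}}"
  have "\<bar>\<Sum>p\<in>?P. ts (p i) * likelihood n ts p x\<bar> \<le> (\<Sum>p\<in>?P. b * likelihood n ts p x)"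
  proof (rule order_trans[OF sum_abs sum_mono])
    fix p assume "p \<in> ?P"
    hence "p i < n" using permutes_in_image[of p "{..<n}" i] i by simp
    thus "\<bar>ts (p i) * likelihood n ts p x\<bar> \<le> b * likelihood n ts p x"
      unfolding abs_mult using ts[of "p i"] likelihood_pos[of n ts p x] by (intro mult_mono) auto
  qed
  thus ?thesis unfolding oracle_mean_def abs_divide
    using sum_likelihood_pos[of n ts x] by (simp add: divide_le_eq flip: sum_distrib_left)
qed

lemma AE_abs_theta_le:
  assumes ts: "\<And>k. k < n \<Longrightarrow> \<bar>ts k\<bar> \<le> b" and i: "i < n"
  shows "AE \<omega> in perm_gauss_space n. \<bar>theta_rv ts i \<omega>\<bar> \<le> b"
  using AE_perm_gauss_permutes
proof eventually_elim
  case (elim \<omega>)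
  thus ?case using permutes_in_image[OF elim, of i] i ts by (simp add: theta_rv_def)
qed

lemma pi_est_oracle_mean:
  assumes ts: "\<And>k. k < n \<Longrightarrow> \<bar>ts k\<bar> \<le> b" and i: "i < n"
  shows "AE \<omega> in perm_gauss_space n. pi_est n ts i \<omega> = oracle_mean n ts i (obs_vec n ts \<omega>)"
  unfolding pi_est_eq
proof -
  let ?P = "perm_gauss_space n" and ?S = "{p. p permutes {..<n}}"
  interpret prob_space ?P by (rule prob_space_perm_gauss)
  interpret finite_measure_subalgebra ?P "obs_algebra n ts" by unfold_locales (rule subalgebra_obs)
  let ?t = "theta_rv ts i" and ?m = "\<lambda>\<omega>. oracle_mean n ts i (obs_vec n ts \<omega>)"
  have tb: "AE \<omega> in ?P. \<bar>?t \<omega>\<bar> \<le> b" by (rule AE_abs_theta_le) (fact ts i)+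
  have omb: "\<bar>oracle_mean n ts i x\<bar> \<le> b" for x by (rule abs_oracle_mean_le) (fact ts i)+
  have tint: "integrable ?P ?t" by (rule integrable_const_bound[where B = b]) (use tb in auto)
  have mint: "integrable ?P ?m"
    by (rule integrable_const_bound[where B = b]) (use omb in auto)
  show "AE \<omega> in ?P. real_cond_exp ?P (obs_algebra n ts) ?t \<omega> = ?m \<omega>"
  proof (rule real_cond_exp_charact[OF _ tint mint])
    show "?m \<in> borel_measurable (obs_algebra n ts)"
      by (rule measurable_compose[OF measurable_obs_algebra measurable_oracle_mean])
    fix A assume "A \<in> sets (obs_algebra n ts)"
    then obtain A' where A'[measurable]: "A' \<in> sets (\<Pi>\<^sub>M j\<in>{..<n}. borel)"
      and A: "A = obs_vec n ts -` A' \<inter> space ?P"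
      unfolding obs_algebra_def
      by (subst (asm) sets_vimage_algebra2) (auto intro: measurable_space[OF measurable_obs_vec])
    have AM[measurable]: "A \<in> sets ?P" unfolding A by measurable
    define U where "U \<omega> = indicator A \<omega> * (?t \<omega> + b)" for \<omega>
    define V where "V \<omega> = indicator A \<omega> * (?m \<omega> + b)" for \<omega>
    have ind: "indicator A \<omega> = (indicator A' (obs_vec n ts \<omega>) :: real)" if "\<omega> \<in> space ?P" for \<omega>
      using that by (auto simp: A indicator_def)
    have indI: "integrable ?P (\<lambda>\<omega>. indicator A \<omega> * w \<omega>)" if "integrable ?P w" for w :: "_ \<Rightarrow> real"
      using integrable_mult_indicator[OF AM that] by (simp add: mult.commute)
    have Uint: "integrable ?P U" unfolding U_def by (intro indI Bochner_Integration.integrable_add tint) simp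
    have Vint: "integrable ?P V" unfolding V_def by (intro indI Bochner_Integration.integrable_add mint) simp
    have Unn: "AE \<omega> in ?P. 0 \<le> U \<omega>" using tb by eventually_elim (auto simp: U_def indicator_def)
    have mb: "0 \<le> oracle_mean n ts i x + b" for x using omb[of x] by auto
    have Vnn: "AE \<omega> in ?P. 0 \<le> V \<omega>" using mb by (auto simp: V_def indicator_def)
    have tsb: "0 \<le> ts (p i) + b" if "p \<in> ?S" for p
      using ts[of "p i"] permutes_in_image[of p "{..<n}" i] that i by auto
    have "(\<integral>\<^sup>+\<omega>. ennreal (U \<omega>) \<partial>?P)
        = (\<integral>\<^sup>+\<omega>. ennreal (indicator A' (obs_vec n ts \<omega>) * (ts (fst \<omega> i) + b)) \<partial>?P)"
      by (intro nn_integral_cong) (simp add: U_def ind theta_rv_def)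
    also have "\<dots> = (\<integral>\<^sup>+x. (\<Sum>p\<in>?S. ennreal (indicator A' x * (ts (p i) + b)) * ennreal (\<Prod>j<n. normal_density (ts (p j)) 1 (x j))) / ennreal (fact n)
            \<partial>(\<Pi>\<^sub>M j\<in>{..<n}. lborel))"
      by (rule nn_integral_obs_vec[where H = "\<lambda>p x. ennreal (indicator A' x * (ts (p i) + b))"]) measurable
    also have "\<dots> = (\<integral>\<^sup>+x. (\<Sum>p\<in>?S. ennreal (indicator A' x * (oracle_mean n ts i x + b)) * ennreal (\<Prod>j<n. normal_density (ts (p j)) 1 (x j))) / ennreal (fact n)
            \<partial>(\<Pi>\<^sub>M j\<in>{..<n}. lborel))"
    proof (intro nn_integral_cong arg_cong2[where f = "(/)"] refl)
      fix x :: "nat \<Rightarrow> real"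
      have nn: "0 \<le> indicator A' x * y * likelihood n ts p x" if "0 \<le> y" for y p
        using that likelihood_pos[of n ts p x] by simp
      have "(\<Sum>p\<in>?S. ennreal (indicator A' x * (ts (p i) + b)) * ennreal (likelihood n ts p x))
         = ennreal (\<Sum>p\<in>?S. indicator A' x * (ts (p i) + b) * likelihood n ts p x)"
        using nn[OF tsb] tsb less_imp_le[OF likelihood_pos[of n ts _ x]]
        by (subst sum_ennreal[symmetric]) (auto simp: ennreal_mult)
      also have "(\<Sum>p\<in>?S. indicator A' x * (ts (p i) + b) * likelihood n ts p x)
         = indicator A' x * ((\<Sum>p\<in>?S. ts (p i) * likelihood n ts p x) + b * (\<Sum>p\<in>?S. likelihood n ts p x))"
        by (simp add: sum_distrib_left algebra_simps sum.distrib)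
      also have "(\<Sum>p\<in>?S. ts (p i) * likelihood n ts p x) = oracle_mean n ts i x * (\<Sum>p\<in>?S. likelihood n ts p x)"
        using sum_likelihood_pos[of n ts x] by (simp add: oracle_mean_def)
      also have "indicator A' x * (oracle_mean n ts i x * (\<Sum>p\<in>?S. likelihood n ts p x) + b * (\<Sum>p\<in>?S. likelihood n ts p x))
         = (\<Sum>p\<in>?S. indicator A' x * (oracle_mean n ts i x + b) * likelihood n ts p x)"
        by (simp add: sum_distrib_left algebra_simps sum.distrib)
      also have "ennreal \<dots> = (\<Sum>p\<in>?S. ennreal (indicator A' x * (oracle_mean n ts i x + b)) * ennreal (likelihood n ts p x))"
        using nn[OF mb] mb less_imp_le[OF likelihood_pos[of n ts _ x]]
        by (subst sum_ennreal[symmetric]) (auto simp: ennreal_mult)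
      finally show "(\<Sum>p\<in>?S. ennreal (indicator A' x * (ts (p i) + b)) * ennreal (\<Prod>j<n. normal_density (ts (p j)) 1 (x j)))
         = (\<Sum>p\<in>?S. ennreal (indicator A' x * (oracle_mean n ts i x + b)) * ennreal (\<Prod>j<n. normal_density (ts (p j)) 1 (x j)))"
        unfolding likelihood_def .
    qed
    also have "\<dots> = (\<integral>\<^sup>+\<omega>. ennreal (indicator A' (obs_vec n ts \<omega>) * (oracle_mean n ts i (obs_vec n ts \<omega>) + b)) \<partial>?P)"
      by (rule nn_integral_obs_vec[where H = "\<lambda>p x. ennreal (indicator A' x * (oracle_mean n ts i x + b))", symmetric]) measurable
    also have "\<dots> = (\<integral>\<^sup>+\<omega>. ennreal (V \<omega>) \<partial>?P)"
      by (intro nn_integral_cong) (simp add: V_def ind)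
    finally have "(\<integral>\<omega>. U \<omega> \<partial>?P) = (\<integral>\<omega>. V \<omega> \<partial>?P)"
      using Unn Vnn by (simp add: nn_integral_eq_integral[OF Uint] nn_integral_eq_integral[OF Vint] integral_nonneg_AE)
    moreover have "U = (\<lambda>\<omega>. indicator A \<omega> * ?t \<omega> + b * indicator A \<omega>)" "V = (\<lambda>\<omega>. indicator A \<omega> * ?m \<omega> + b * indicator A \<omega>)"
      by (auto simp: U_def V_def fun_eq_iff algebra_simps)
    ultimately have "(\<integral>\<omega>. indicator A \<omega> * ?t \<omega> \<partial>?P) = (\<integral>\<omega>. indicator A \<omega> * ?m \<omega> \<partial>?P)"
      using indI[OF tint] indI[OF mint] indI[of "\<lambda>_. 1"] by simp
    thus "(\<integral>\<omega>\<in>A. ?t \<omega> \<partial>?P) = (\<integral>\<omega>\<in>A. ?m \<omega> \<partial>?P)"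
      by (simp add: set_lebesgue_integral_def)
  qed
qed

lemma nn_integral_perm_gauss_noise:
  assumes i: "i < n" and W[measurable]: "W \<in> borel_measurable borel"
  shows "(\<integral>\<^sup>+\<omega>. W (snd \<omega> i) \<partial>perm_gauss_space n) = (\<integral>\<^sup>+z. W z * ennreal (std_normal_density z) \<partial>lborel)"
proof -
  have "(\<integral>\<^sup>+\<omega>. W (snd \<omega> i) \<partial>perm_gauss_space n)
      = (\<Sum>p\<in>{p. p permutes {..<n}}. \<integral>\<^sup>+z. W (z i) \<partial>(\<Pi>\<^sub>M i\<in>{..<n}. density lborel std_normal_density)) / ennreal (fact n)"
    using nn_integral_perm_gauss[OF measurable_compose[OF measurable_perm_gauss_snd[OF i] W]] by simp
  also have "\<dots> = (\<integral>\<^sup>+z. W (z i) \<partial>(\<Pi>\<^sub>M i\<in>{..<n}. density lborel std_normal_density))"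
    by (simp add: card_permutations ennreal_of_nat_eq_real_of_nat)
       (simp add: mult.commute[of "ennreal (fact n)"] ennreal_mult_divide_eq)
  also have "\<dots> = (\<integral>\<^sup>+z. W z * ennreal (std_normal_density z) \<partial>lborel)"
    using nn_integral_PiM_normal_shift_component[OF W i, of 0] by simp
  finally show ?thesis .
qed

lemma perm_gauss_noise_square:
  assumes i: "i < n"
  shows "integrable (perm_gauss_space n) (\<lambda>\<omega>. (snd \<omega> i)\<^sup>2)"
    and "(\<integral>\<omega>. (snd \<omega> i)\<^sup>2 \<partial>perm_gauss_space n) = 1"
proof -
  have sq: "has_bochner_integral lborel (\<lambda>z. std_normal_density z * z\<^sup>2) 1"
    using normal_moment_even[of 1 0 1] by simp
  have "(\<integral>\<^sup>+\<omega>. ennreal ((snd \<omega> i)\<^sup>2) \<partial>perm_gauss_space n) = (\<integral>\<^sup>+z. ennreal (z\<^sup>2) * ennreal (std_normal_density z) \<partial>lborel)"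
    by (rule nn_integral_perm_gauss_noise[OF i]) simp
  also have "\<dots> = (\<integral>\<^sup>+z. ennreal (std_normal_density z * z\<^sup>2) \<partial>lborel)"
    by (simp add: mult.commute flip: ennreal_mult)
  also have "\<dots> = ennreal 1"
    using sq by (subst nn_integral_eq_integral) (auto simp: has_bochner_integral_iff)
  finally have "has_bochner_integral (perm_gauss_space n) (\<lambda>\<omega>. (snd \<omega> i)\<^sup>2) 1"
    by (intro has_bochner_integral_nn_integral) (use measurable_perm_gauss_snd[OF i] in auto)
  thus "integrable (perm_gauss_space n) (\<lambda>\<omega>. (snd \<omega> i)\<^sup>2)" "(\<integral>\<omega>. (snd \<omega> i)\<^sup>2 \<partial>perm_gauss_space n) = 1"
    by (auto simp: has_bochner_integral_iff)
qed

lemma nn_integral_exp_std_normal: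
  "(\<integral>\<^sup>+z. ennreal (exp (a * z)) * ennreal (std_normal_density z) \<partial>lborel) = ennreal (exp (a\<^sup>2 / 2))"
proof -
  have "exp (a * z) * std_normal_density z = exp (a\<^sup>2 / 2) * normal_density a 1 z" for z
    by (simp add: normal_density_def exp_add[symmetric] mult_ac) (simp add: power2_eq_square field_simps)
  hence "(\<integral>\<^sup>+z. ennreal (exp (a * z)) * ennreal (std_normal_density z) \<partial>lborel)
      = (\<integral>\<^sup>+z. ennreal (exp (a\<^sup>2 / 2)) * ennreal (normal_density a 1 z) \<partial>lborel)"
    by (simp flip: ennreal_mult)
  also have "\<dots> = ennreal (exp (a\<^sup>2 / 2)) * (\<integral>\<^sup>+z. ennreal (normal_density a 1 z) \<partial>lborel)"
    by (rule nn_integral_cmult) simp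
  also have "(\<integral>\<^sup>+z. ennreal (normal_density a 1 z) \<partial>lborel) = 1"
    by (subst nn_integral_eq_integral) auto
  finally show ?thesis by simp
qed

lemma max_abs_square_le_exp:
  fixes z a :: real
  assumes a: "0 < a"
  shows "(max 0 (\<bar>z\<bar> - a))\<^sup>2 \<le> 2 / a\<^sup>2 * exp (- a\<^sup>2) * (exp (a * z) + exp (- a * z))"
proof (cases "\<bar>z\<bar> \<le> a")
  case False
  have "a\<^sup>2 * (\<bar>z\<bar> - a)\<^sup>2 / 2 \<le> exp (a * (\<bar>z\<bar> - a))"
  proof -
    have "0 \<le> a * (\<bar>z\<bar> - a)" using a False by simp
    from exp_lower_Taylor_quadratic[OF this] this show ?thesis by (simp add: power_mult_distrib)
  qed
  also have "\<dots> = exp (- a\<^sup>2) * exp (a * \<bar>z\<bar>)" by (simp add: power2_eq_square algebra_simps flip: exp_add)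
  also have "\<dots> \<le> exp (- a\<^sup>2) * (exp (a * z) + exp (- a * z))"
    by (intro mult_left_mono) (cases "0 \<le> z"; simp)+
  finally have "a\<^sup>2 * (\<bar>z\<bar> - a)\<^sup>2 \<le> 2 * exp (- a\<^sup>2) * (exp (a * z) + exp (- a * z))" by simp
  hence "(\<bar>z\<bar> - a)\<^sup>2 \<le> 2 * exp (- a\<^sup>2) * (exp (a * z) + exp (- a * z)) / a\<^sup>2"
    using a by (simp add: le_divide_eq mult.commute)
  thus ?thesis using False by (simp add: max_def)
qed (simp add: max_def add_nonneg_nonneg)

lemma perm_gauss_noise_excess:
  assumes i: "i < n" and a: "0 < a"
  shows "integrable (perm_gauss_space n) (\<lambda>\<omega>. (max 0 (\<bar>snd \<omega> i\<bar> - a))\<^sup>2)"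
    and "(\<integral>\<omega>. (max 0 (\<bar>snd \<omega> i\<bar> - a))\<^sup>2 \<partial>perm_gauss_space n) \<le> 4 / a\<^sup>2 * exp (- a\<^sup>2 / 2)"
proof -
  let ?W = "\<lambda>z. (max 0 (\<bar>z\<bar> - a))\<^sup>2" and ?C = "2 / a\<^sup>2 * exp (- a\<^sup>2)"
  have Wm: "(\<lambda>\<omega>. ?W (snd \<omega> i)) \<in> borel_measurable (perm_gauss_space n)"
    using measurable_perm_gauss_snd[OF i] by measurable
  have "(\<integral>\<^sup>+\<omega>. ennreal (?W (snd \<omega> i)) \<partial>perm_gauss_space n) = (\<integral>\<^sup>+z. ennreal (?W z) * ennreal (std_normal_density z) \<partial>lborel)"
    by (rule nn_integral_perm_gauss_noise[OF i]) simp
  also have "\<dots> \<le> (\<integral>\<^sup>+z. ennreal ?C * (ennreal (exp (a * z)) * ennreal (std_normal_density z)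
                       + ennreal (exp (- a * z)) * ennreal (std_normal_density z)) \<partial>lborel)"
  proof (rule nn_integral_mono)
    fix z :: real
    have "?W z * std_normal_density z \<le> ?C * (exp (a * z) + exp (- a * z)) * std_normal_density z"
      by (intro mult_right_mono max_abs_square_le_exp a) simp
    also have "\<dots> = ?C * (exp (a * z) * std_normal_density z + exp (- a * z) * std_normal_density z)"
      by (simp add: algebra_simps add_divide_distrib)
    finally have "ennreal (?W z * std_normal_density z) \<le> ennreal \<dots>" by (rule ennreal_leI)
    also have "\<dots> = ennreal ?C * ennreal (exp (a * z) * std_normal_density z + exp (- a * z) * std_normal_density z)"
      by (rule ennreal_mult) auto
    also have "ennreal (exp (a * z) * std_normal_density z + exp (- a * z) * std_normal_density z)
        = ennreal (exp (a * z)) * ennreal (std_normal_density z) + ennreal (exp (- a * z)) * ennreal (std_normal_density z)"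
      by (simp add: ennreal_mult)
    finally show "ennreal (?W z) * ennreal (std_normal_density z) \<le> ennreal ?C * (ennreal (exp (a * z)) * ennreal (std_normal_density z)
                       + ennreal (exp (- a * z)) * ennreal (std_normal_density z))"
      by (simp add: ennreal_mult)
  qed
  also have "\<dots> = ennreal ?C * (ennreal (exp (a\<^sup>2 / 2)) + ennreal (exp (a\<^sup>2 / 2)))"
    by (subst nn_integral_cmult, simp, subst nn_integral_add)
       (use nn_integral_exp_std_normal[of a] nn_integral_exp_std_normal[of "- a"] in simp_all)
  also have "ennreal (exp (a\<^sup>2 / 2)) + ennreal (exp (a\<^sup>2 / 2)) = ennreal (exp (a\<^sup>2 / 2) + exp (a\<^sup>2 / 2))"
    by (rule ennreal_plus[symmetric]) auto
  also have "ennreal ?C * \<dots> = ennreal (?C * (exp (a\<^sup>2 / 2) + exp (a\<^sup>2 / 2)))"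
    by (rule ennreal_mult[symmetric]) auto
  also have "?C * (exp (a\<^sup>2 / 2) + exp (a\<^sup>2 / 2)) = 4 / a\<^sup>2 * exp (- a\<^sup>2 / 2)"
  proof -
    have "exp (- a\<^sup>2) * exp (a\<^sup>2 / 2) = exp (- a\<^sup>2 / 2)" by (simp flip: exp_add)
    thus ?thesis by simp
  qed
  finally have le: "(\<integral>\<^sup>+\<omega>. ennreal (?W (snd \<omega> i)) \<partial>perm_gauss_space n) \<le> ennreal (4 / a\<^sup>2 * exp (- a\<^sup>2 / 2))" .
  also have "\<dots> < \<infinity>" by simp
  finally show int: "integrable (perm_gauss_space n) (\<lambda>\<omega>. ?W (snd \<omega> i))"
    by (intro integrableI_nonneg Wm) auto
  show "(\<integral>\<omega>. ?W (snd \<omega> i) \<partial>perm_gauss_space n) \<le> 4 / a\<^sup>2 * exp (- a\<^sup>2 / 2)"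
    using le by (subst (asm) nn_integral_eq_integral[OF int]) (auto simp: ennreal_le_iff)
qed

subsection \<open>Dyadic decomposition\<close>

definition grid :: "nat \<Rightarrow> real \<Rightarrow> real" where
  "grid j t = real_of_int \<lfloor>2 ^ j * t\<rfloor> / 2 ^ j"

lemma grid_le: "grid j t \<le> t"
  by (simp add: grid_def divide_le_eq mult.commute)

lemma grid_gt: "t < grid j t + 1 / 2 ^ j"
proof -
  have "2 ^ j * t < real_of_int \<lfloor>2 ^ j * t\<rfloor> + 1" by linarith
  thus ?thesis by (simp add: grid_def field_simps)
qed

lemma grid_Suc_ge: "grid j t \<le> grid (Suc j) t"
proof -
  have "2 * \<lfloor>2 ^ j * t\<rfloor> \<le> \<lfloor>2 ^ Suc j * t\<rfloor>"
    by (simp add: le_floor_iff mult.assoc)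
  hence "2 * real_of_int \<lfloor>2 ^ j * t\<rfloor> \<le> real_of_int \<lfloor>2 ^ Suc j * t\<rfloor>" by linarith
  thus ?thesis by (simp add: grid_def field_simps)
qed

lemma grid_Suc_le: "grid (Suc j) t \<le> grid j t + 1 / 2 ^ j"
  using grid_le[of "Suc j" t] grid_gt[of t j] by linarith

lemma grid_cong_Suc: "\<lfloor>2 ^ Suc j * s\<rfloor> = \<lfloor>2 ^ Suc j * t\<rfloor> \<Longrightarrow> grid j s = grid j t"
proof -
  assume eq: "\<lfloor>2 ^ Suc j * s\<rfloor> = \<lfloor>2 ^ Suc j * t\<rfloor>"
  have "\<lfloor>2 ^ j * u\<rfloor> = \<lfloor>2 ^ Suc j * u\<rfloor> div 2" for u :: real
    using floor_divide_real_eq_div[of 2 "2 ^ Suc j * u"] by simp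
  thus ?thesis using eq by (simp only: grid_def)
qed

lemma grid_cell_diam:
  fixes s t :: real
  assumes "\<lfloor>2 ^ j * s\<rfloor> = \<lfloor>2 ^ j * t\<rfloor>"
  shows "\<bar>s - t\<bar> \<le> 1"
proof -
  have "grid j s = grid j t" using assms by (simp only: grid_def)
  hence "\<bar>s - t\<bar> \<le> 1 / 2 ^ j" using grid_le[of j s] grid_gt[of s j] grid_le[of j t] grid_gt[of t j] by linarith
  also have "\<dots> \<le> 1" by simp
  finally show ?thesis .
qed

lemma card_grid_cells_le:
  fixes ts :: "nat \<Rightarrow> real" and m :: real
  assumes m: "1 \<le> m" and ts: "\<And>k. k < n \<Longrightarrow> \<bar>ts k\<bar> \<le> m"
  shows "real (card ((\<lambda>k. \<lfloor>2 ^ j * ts k\<rfloor>) ` {..<n})) \<le> 4 * 2 ^ j * m"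
proof -
  let ?y = "2 ^ j * m"
  have y: "1 \<le> ?y" using mult_mono[of 1 "2 ^ j" 1 m] m by simp
  have "(\<lambda>k. \<lfloor>2 ^ j * ts k\<rfloor>) ` {..<n} \<subseteq> {\<lfloor>- ?y\<rfloor>..\<lfloor>?y\<rfloor>}"
  proof (rule image_subsetI)
    fix k assume "k \<in> {..<n}"
    hence "- m \<le> ts k" "ts k \<le> m" using ts[of k] by auto
    hence "2 ^ j * (- m) \<le> 2 ^ j * ts k" "2 ^ j * ts k \<le> ?y" by (intro mult_left_mono; simp)+
    thus "\<lfloor>2 ^ j * ts k\<rfloor> \<in> {\<lfloor>- ?y\<rfloor>..\<lfloor>?y\<rfloor>}" by (auto intro!: floor_mono)
  qed
  hence "card ((\<lambda>k. \<lfloor>2 ^ j * ts k\<rfloor>) ` {..<n}) \<le> card {\<lfloor>- ?y\<rfloor>..\<lfloor>?y\<rfloor>}" by (intro card_mono) auto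
  hence "real (card ((\<lambda>k. \<lfloor>2 ^ j * ts k\<rfloor>) ` {..<n})) \<le> real (nat (\<lfloor>?y\<rfloor> - \<lfloor>- ?y\<rfloor> + 1))" by simp
  also have "\<dots> \<le> 2 * ?y + 2" using y by linarith
  also have "\<dots> \<le> 4 * ?y" using y by linarith
  finally show ?thesis by simp
qed

definition clamp_real :: "real \<Rightarrow> real \<Rightarrow> real" where
  "clamp_real m x = max (- m) (min m x)"

text \<open>Clamping the center to \<open>[-m, m]\<close> keeps the clipped value bounded in \<open>x\<close>, and does not increase the
  clipping error for \<open>t\<close> in \<open>[-m, m]\<close>.\<close>

definition window :: "real \<Rightarrow> real \<Rightarrow> real \<Rightarrow> real \<Rightarrow> real" where
  "window m r x t = max (clamp_real m x - r) (min (clamp_real m x + r) t)"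

lemma window_range:
  assumes "0 \<le> r"
  shows "clamp_real m x - r \<le> window m r x t \<and> window m r x t \<le> clamp_real m x - r + 2 * r"
  using assms by (auto simp: window_def)

lemma abs_window_le: "0 \<le> m \<Longrightarrow> 0 \<le> r \<Longrightarrow> \<bar>window m r x t\<bar> \<le> m + r"
  unfolding window_def clamp_real_def by linarith

lemma window_dist_le:
  assumes "\<bar>t\<bar> \<le> m" "0 \<le> r"
  shows "\<bar>t - window m r x t\<bar> \<le> max 0 (\<bar>x - t\<bar> - r)"
  using assms unfolding window_def clamp_real_def by linarith

lemma square_add_le:
  fixes u v :: real
  shows "(u + v)\<^sup>2 \<le> 2 * u\<^sup>2 + 2 * v\<^sup>2"
  using sum_squares_ge_zero[of "u - v" 0] by (simp add: power2_eq_square algebra_simps)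

lemma separable_gap_le:
  fixes ts :: "nat \<Rightarrow> real" and h :: "real \<Rightarrow> real"
  assumes ts: "\<And>k. k < n \<Longrightarrow> \<bar>ts k\<bar> \<le> b" and i: "i < n"
    and h: "h \<in> borel_measurable borel" and h2: "integrable (perm_gauss_space n) (\<lambda>\<omega>. (h (obs_rv ts i \<omega>))\<^sup>2)"
  shows "integrable (perm_gauss_space n) (\<lambda>\<omega>. (sep_est n ts i \<omega> - pi_est n ts i \<omega>)\<^sup>2)"
    and "(\<integral>\<omega>. (sep_est n ts i \<omega> - pi_est n ts i \<omega>)\<^sup>2 \<partial>perm_gauss_space n)
           \<le> (\<integral>\<omega>. (oracle_mean n ts i (obs_vec n ts \<omega>) - h (obs_rv ts i \<omega>))\<^sup>2 \<partial>perm_gauss_space n)"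
    and "(\<integral>\<omega>. (sep_est n ts i \<omega> - pi_est n ts i \<omega>)\<^sup>2 \<partial>perm_gauss_space n)
           \<le> (\<integral>\<omega>. (theta_rv ts i \<omega> - h (obs_rv ts i \<omega>))\<^sup>2 \<partial>perm_gauss_space n)"
proof -
  let ?P = "perm_gauss_space n"
  interpret prob_space ?P by (rule prob_space_perm_gauss)
  have tb: "AE \<omega> in ?P. \<bar>theta_rv ts i \<omega>\<bar> \<le> b" by (rule AE_abs_theta_le) (fact ts i)+
  have hF: "(\<lambda>\<omega>. h (obs_rv ts i \<omega>)) \<in> borel_measurable (coord_algebra n ts i)"
    by (rule measurable_compose[OF measurable_coord_algebra h])
  note D = real_cond_exp_nested_diff_le[OF subalgebra_obs subalgebra_coord[OF i] measurable_theta_rv tb hF h2]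
  show "integrable ?P (\<lambda>\<omega>. (sep_est n ts i \<omega> - pi_est n ts i \<omega>)\<^sup>2)"
    unfolding sep_est_eq pi_est_eq by (rule D(1))
  have [measurable]: "obs_rv ts i \<in> borel_measurable ?P" by (rule measurable_obs_rv[OF i])
  have [measurable]: "pi_est n ts i \<in> borel_measurable ?P"
    unfolding pi_est_eq by (rule borel_measurable_cond_exp2)
  have o: "AE \<omega> in ?P. pi_est n ts i \<omega> = oracle_mean n ts i (obs_vec n ts \<omega>)"
    by (rule pi_est_oracle_mean) (fact ts i)+
  have "(\<integral>\<omega>. (pi_est n ts i \<omega> - h (obs_rv ts i \<omega>))\<^sup>2 \<partial>?P)
      = (\<integral>\<omega>. (oracle_mean n ts i (obs_vec n ts \<omega>) - h (obs_rv ts i \<omega>))\<^sup>2 \<partial>?P)"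
    by (rule integral_cong_AE) (use h o in auto)
  thus "(\<integral>\<omega>. (sep_est n ts i \<omega> - pi_est n ts i \<omega>)\<^sup>2 \<partial>?P)
           \<le> (\<integral>\<omega>. (oracle_mean n ts i (obs_vec n ts \<omega>) - h (obs_rv ts i \<omega>))\<^sup>2 \<partial>?P)"
    using D(2) unfolding sep_est_eq pi_est_eq by simp
  show "(\<integral>\<omega>. (sep_est n ts i \<omega> - pi_est n ts i \<omega>)\<^sup>2 \<partial>?P)
           \<le> (\<integral>\<omega>. (theta_rv ts i \<omega> - h (obs_rv ts i \<omega>))\<^sup>2 \<partial>?P)"
    using D(3) unfolding sep_est_eq pi_est_eq .
qed

lemma integral_oracle_mean_times:
  fixes ts :: "nat \<Rightarrow> real"
  assumes ts: "\<And>k. k < n \<Longrightarrow> \<bar>ts k\<bar> \<le> b" and i: "i < n"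
    and F[measurable]: "F \<in> borel_measurable (\<Pi>\<^sub>M j\<in>{..<n}. borel)" and FB: "\<And>x. \<bar>F x\<bar> \<le> B"
  shows "(\<integral>\<omega>. F (obs_vec n ts \<omega>) * oracle_mean n ts i (obs_vec n ts \<omega>) \<partial>perm_gauss_space n)
       = (\<integral>\<omega>. F (obs_vec n ts \<omega>) * theta_rv ts i \<omega> \<partial>perm_gauss_space n)"
proof -
  let ?P = "perm_gauss_space n"
  interpret prob_space ?P by (rule prob_space_perm_gauss)
  interpret finite_measure_subalgebra ?P "obs_algebra n ts" by unfold_locales (rule subalgebra_obs)
  have tb: "AE \<omega> in ?P. \<bar>theta_rv ts i \<omega>\<bar> \<le> b" by (rule AE_abs_theta_le) (fact ts i)+
  have o: "AE \<omega> in ?P. pi_est n ts i \<omega> = oracle_mean n ts i (obs_vec n ts \<omega>)"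
    by (rule pi_est_oracle_mean) (fact ts i)+
  have [measurable]: "pi_est n ts i \<in> borel_measurable ?P"
    unfolding pi_est_eq by (rule borel_measurable_cond_exp2)
  have int: "integrable ?P (\<lambda>\<omega>. F (obs_vec n ts \<omega>) * theta_rv ts i \<omega>)"
  proof (rule integrable_const_bound[where B = "B * b"])
    show "AE \<omega> in ?P. norm (F (obs_vec n ts \<omega>) * theta_rv ts i \<omega>) \<le> B * b"
      using tb
    proof eventually_elim
      case (elim \<omega>)
      have "0 \<le> B" using FB[of "\<lambda>_. 0"] by linarith
      thus ?case unfolding real_norm_def abs_mult using FB[of "obs_vec n ts \<omega>"] elim by (intro mult_mono) auto
    qed
  qed measurable
  have "(\<integral>\<omega>. F (obs_vec n ts \<omega>) * oracle_mean n ts i (obs_vec n ts \<omega>) \<partial>?P)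
      = (\<integral>\<omega>. F (obs_vec n ts \<omega>) * pi_est n ts i \<omega> \<partial>?P)"
    by (rule integral_cong_AE) (use o in auto)
  also have "\<dots> = (\<integral>\<omega>. F (obs_vec n ts \<omega>) * theta_rv ts i \<omega> \<partial>?P)"
    unfolding pi_est_eq
    by (rule real_cond_exp_intg(2)[OF int]) (auto intro: measurable_compose[OF measurable_obs_algebra F])
  finally show ?thesis .
qed

lemma obs_rv_square_integrable:
  fixes ts :: "nat \<Rightarrow> real"
  assumes ts: "\<And>k. k < n \<Longrightarrow> \<bar>ts k\<bar> \<le> b" and i: "i < n"
  shows "integrable (perm_gauss_space n) (\<lambda>\<omega>. (obs_rv ts i \<omega>)\<^sup>2)"
proof (rule Bochner_Integration.integrable_bound)
  let ?P = "perm_gauss_space n"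
  interpret prob_space ?P by (rule prob_space_perm_gauss)
  show "integrable ?P (\<lambda>\<omega>. 2 * b\<^sup>2 + 2 * (snd \<omega> i)\<^sup>2)"
    using perm_gauss_noise_square(1)[OF i] by simp
  have [measurable]: "obs_rv ts i \<in> borel_measurable ?P" by (rule measurable_obs_rv[OF i])
  show "(\<lambda>\<omega>. (obs_rv ts i \<omega>)\<^sup>2) \<in> borel_measurable ?P" by measurable
  have "AE \<omega> in ?P. \<bar>theta_rv ts i \<omega>\<bar> \<le> b" by (rule AE_abs_theta_le) (fact ts i)+
  thus "AE \<omega> in ?P. norm ((obs_rv ts i \<omega>)\<^sup>2) \<le> norm (2 * b\<^sup>2 + 2 * (snd \<omega> i)\<^sup>2)"
  proof eventually_elim
    case (elim \<omega>)
    have "(theta_rv ts i \<omega>)\<^sup>2 \<le> b\<^sup>2" using elim by (metis abs_ge_zero power2_abs power_mono)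
    thus ?case using square_add_le[of "theta_rv ts i \<omega>" "snd \<omega> i"]
      by (simp add: obs_rv_def theta_rv_def)
  qed
qed

lemma sum_power_le:
  fixes x :: real
  assumes "0 \<le> x" "x < 1"
  shows "(\<Sum>j<n. x ^ j) \<le> 1 / (1 - x)"
proof -
  have "(\<Sum>j<n. x ^ j) = (1 - x ^ n) / (1 - x)" using assms by (simp add: sum_gp_strict)
  also have "\<dots> \<le> 1 / (1 - x)" using assms by (intro divide_right_mono) auto
  finally show ?thesis .
qed

lemma ln_ge_half: "2 \<le> n \<Longrightarrow> 1 / 2 \<le> ln (real n)"
proof -
  assume n: "2 \<le> n"
  have "(exp (1 / 2 :: real))\<^sup>2 = exp 1" by (simp flip: exp_double)
  also have "\<dots> \<le> 2\<^sup>2" using exp_le by simp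
  finally have "exp (1 / 2 :: real) \<le> 2" by (rule power2_le_imp_le) simp
  also have "\<dots> \<le> real n" using n by simp
  finally show ?thesis using n by (subst ln_ge_iff) auto
qed

definition level :: "(nat \<Rightarrow> real) \<Rightarrow> nat \<Rightarrow> nat \<Rightarrow> real \<Rightarrow> real" where
  "level ts j k x = grid (Suc j) (ts k) - grid j (ts k)"

definition coarse :: "(nat \<Rightarrow> real) \<Rightarrow> real \<Rightarrow> real \<Rightarrow> nat \<Rightarrow> real \<Rightarrow> real" where
  "coarse ts m r k x = window m r x (grid 0 (ts k))"

definition multiscale_rule :: "nat \<Rightarrow> (nat \<Rightarrow> real) \<Rightarrow> real \<Rightarrow> real \<Rightarrow> real \<Rightarrow> real" where
  "multiscale_rule n ts m r x = post_mean n ts (coarse ts m r) x + (\<Sum>j<n. post_mean n ts (level ts j) x)"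

definition rule_gap :: "nat \<Rightarrow> (nat \<Rightarrow> real) \<Rightarrow> real \<Rightarrow> real \<Rightarrow> nat \<Rightarrow> (nat \<Rightarrow> real) \<Rightarrow> real" where
  "rule_gap n ts m r i x = oracle_mean n ts i x - multiscale_rule n ts m r (x i)"

definition residual :: "nat \<Rightarrow> (nat \<Rightarrow> real) \<Rightarrow> real \<Rightarrow> real \<Rightarrow> nat \<Rightarrow> real \<Rightarrow> real" where
  "residual n ts m r k x = ts k - coarse ts m r k x - (\<Sum>j<n. level ts j k x)"

lemma measurable_level[measurable]: "level ts j k \<in> borel_measurable borel"
  unfolding level_def by measurable

lemma measurable_coarse[measurable]: "coarse ts m r k \<in> borel_measurable borel"
  unfolding coarse_def window_def clamp_real_def by measurable

lemma measurable_multiscale_rule[measurable]: "multiscale_rule n ts m r \<in> borel_measurable borel"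
  unfolding multiscale_rule_def by measurable

lemma measurable_rule_gap[measurable]:
  "i < n \<Longrightarrow> rule_gap n ts m r i \<in> borel_measurable (\<Pi>\<^sub>M j\<in>{..<n}. borel)"
  unfolding rule_gap_def by measurable

lemma level_range: "0 \<le> level ts j k x \<and> level ts j k x \<le> 0 + 1 / 2 ^ j"
  using grid_Suc_ge[of j "ts k"] grid_Suc_le[of j "ts k"] by (simp add: level_def)

lemma abs_multiscale_rule_le:
  assumes n: "0 < n" and m: "0 \<le> m" and r: "0 \<le> r"
  shows "\<bar>multiscale_rule n ts m r x\<bar> \<le> m + r + real n"
proof -
  have "- (m + r) \<le> coarse ts m r k x \<and> coarse ts m r k x \<le> m + r" for k
    using abs_window_le[OF m r, of x "grid 0 (ts k)"] by (auto simp: coarse_def)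
  hence "\<bar>post_mean n ts (coarse ts m r) x\<bar> \<le> m + r"
    using post_mean_bounds[OF n, of "- (m + r)" "coarse ts m r" x "m + r" ts] by auto
  moreover have "\<bar>\<Sum>j<n. post_mean n ts (level ts j) x\<bar> \<le> (\<Sum>j<n. 1)"
  proof (rule order_trans[OF sum_abs sum_mono])
    fix j
    have "1 / 2 ^ j \<le> (1 :: real)" by simp
    hence "0 \<le> level ts j k x \<and> level ts j k x \<le> 1" for k using level_range[of ts j k x] by linarith
    thus "\<bar>post_mean n ts (level ts j) x\<bar> \<le> 1"
      using post_mean_bounds[OF n, of 0 "level ts j" x 1 ts] by auto
  qed
  ultimately show ?thesis unfolding multiscale_rule_def by simp
qed

lemma residual_eq:
  "residual n ts m r k x = (ts k - grid n (ts k)) + (grid 0 (ts k) - window m r x (grid 0 (ts k)))"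
proof -
  have "(\<Sum>j<n. level ts j k x) = grid n (ts k) - grid 0 (ts k)"
    unfolding level_def by (rule sum_lessThan_telescope)
  thus ?thesis by (simp add: residual_def coarse_def)
qed

lemma residual_square_le:
  assumes ts: "\<bar>ts k\<bar> \<le> m" and r: "0 \<le> r"
  shows "(residual n ts (m + 1) (r + 1) k (ts k + z))\<^sup>2 \<le> 2 / 4 ^ n + 2 * (max 0 (\<bar>z\<bar> - r))\<^sup>2"
proof -
  let ?t = "ts k" and ?g = "grid 0 (ts k)"
  have g: "?g \<le> ?t" "?t < ?g + 1" using grid_le[of 0 ?t] grid_gt[of ?t 0] by auto
  have "0 \<le> ?t - grid n ?t" "?t - grid n ?t \<le> 1 / 2 ^ n"
    using grid_le[of n ?t] grid_gt[of ?t n] by linarith+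
  hence "(?t - grid n ?t)\<^sup>2 \<le> (1 / 2 ^ n)\<^sup>2" by (intro power_mono)
  also have "\<dots> = 1 / 4 ^ n" by (simp add: power_divide power2_eq_square flip: power_mult_distrib)
  finally have 1: "(?t - grid n ?t)\<^sup>2 \<le> 1 / 4 ^ n" .
  have "\<bar>?g - window (m + 1) (r + 1) (?t + z) ?g\<bar> \<le> max 0 (\<bar>?t + z - ?g\<bar> - (r + 1))"
    by (rule window_dist_le) (use g ts r in auto)
  also have "\<dots> \<le> max 0 (\<bar>z\<bar> - r)" using g by auto
  finally have "\<bar>?g - window (m + 1) (r + 1) (?t + z) ?g\<bar>\<^sup>2 \<le> (max 0 (\<bar>z\<bar> - r))\<^sup>2" by (rule power_mono) simp
  hence 2: "(?g - window (m + 1) (r + 1) (?t + z) ?g)\<^sup>2 \<le> (max 0 (\<bar>z\<bar> - r))\<^sup>2" by simp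
  show ?thesis unfolding residual_eq
    using square_add_le[of "?t - grid n ?t" "?g - window (m + 1) (r + 1) (?t + z) ?g"] 1 2 by simp
qed

lemma rule_gap_bound:
  fixes n :: nat and ts :: "nat \<Rightarrow> real" and m :: real
  assumes n: "2 \<le> n" and m: "1 \<le> m" and ts: "\<And>k. k < n \<Longrightarrow> \<bar>ts k\<bar> \<le> m"
  defines "r \<equiv> sqrt (2 * ln (real n))"
  shows "(\<Sum>i<n. \<integral>\<omega>. (rule_gap n ts (m + 1) (r + 1) i (obs_vec n ts \<omega>))\<^sup>2 \<partial>perm_gauss_space n)
           \<le> 1092 * m * (1 + ln (real n))\<^sup>2"
proof -
  let ?P = "perm_gauss_space n"
  interpret prob_space ?P by (rule prob_space_perm_gauss)
  define L where "L = 1 + ln (real n)"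
  define f where "f = rule_gap n ts (m + 1) (r + 1)"
  define B where "B = m + (m + 1 + (r + 1) + real n)"
  define D where "D = (\<integral>\<omega>. (\<Sum>i<n. (f i (obs_vec n ts \<omega>))\<^sup>2) \<partial>?P)"
  have ln: "1 / 2 \<le> ln (real n)" by (rule ln_ge_half[OF n])
  have L: "1 \<le> L" using ln by (simp add: L_def)
  have mL: "1 \<le> m * L" using mult_mono[of 1 m 1 L] m L by simp
  have LL: "m * L \<le> m * L\<^sup>2" using m L by (simp add: power2_eq_square)
  have r: "0 < r" using ln by (simp add: r_def)
  have r2: "r\<^sup>2 = 2 * ln (real n)" using ln by (simp add: r_def)
  have f_meas[measurable]: "f i \<in> borel_measurable (\<Pi>\<^sub>M j\<in>{..<n}. borel)" if "i < n" for i
    using that unfolding f_def by measurable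
  have f_bound: "\<bar>f i x\<bar> \<le> B" if i: "i < n" for i x
  proof -
    have "\<bar>oracle_mean n ts i x\<bar> \<le> m" by (rule abs_oracle_mean_le) (fact ts i)+
    moreover have "\<bar>multiscale_rule n ts (m + 1) (r + 1) (x i)\<bar> \<le> m + 1 + (r + 1) + real n"
      by (rule abs_multiscale_rule_le) (use n m r in auto)
    ultimately show ?thesis unfolding f_def rule_gap_def B_def by linarith
  qed
  have B0: "0 \<le> B" using f_bound[of 0 "\<lambda>_. 0"] n by force
  have bounded_int: "integrable ?P w" if "AE \<omega> in ?P. \<bar>w \<omega>\<bar> \<le> b" "w \<in> borel_measurable ?P" for w :: "_ \<Rightarrow> real" and b
    by (rule integrable_const_bound[where B = b]) (use that in auto)
  have obs_meas[measurable]: "obs_rv ts i \<in> borel_measurable ?P" if "i < n" for i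
    by (rule measurable_obs_rv[OF that])
  have fint: "integrable ?P (\<lambda>\<omega>. (f i (obs_vec n ts \<omega>))\<^sup>2)" if i: "i < n" for i
  proof (rule bounded_int[of _ "B\<^sup>2"])
    have "(f i x)\<^sup>2 \<le> B\<^sup>2" for x using f_bound[OF i, of x] by (metis abs_ge_zero power2_abs power_mono)
    thus "AE \<omega> in ?P. \<bar>(f i (obs_vec n ts \<omega>))\<^sup>2\<bar> \<le> B\<^sup>2" by simp
  qed (use i in measurable)
  have D_eq: "D = (\<Sum>i<n. \<integral>\<omega>. (f i (obs_vec n ts \<omega>))\<^sup>2 \<partial>?P)"
    unfolding D_def by (rule Bochner_Integration.integral_sum) (use fint in auto)

  define H where "H = multiscale_rule n ts (m + 1) (r + 1)"
  have Hint: "integrable ?P (\<lambda>\<omega>. (theta_rv ts i \<omega> - H (obs_rv ts i \<omega>)) * f i (obs_vec n ts \<omega>))"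
    and Hgap: "(\<integral>\<omega>. (f i (obs_vec n ts \<omega>))\<^sup>2 \<partial>?P) = (\<integral>\<omega>. (theta_rv ts i \<omega> - H (obs_rv ts i \<omega>)) * f i (obs_vec n ts \<omega>) \<partial>?P)"
    if i: "i < n" for i
  proof -
    let ?F = "\<lambda>\<omega>. f i (obs_vec n ts \<omega>)"
    have fm: "?F \<in> borel_measurable ?P" using i by measurable
    have om: "(\<lambda>\<omega>. oracle_mean n ts i (obs_vec n ts \<omega>)) \<in> borel_measurable ?P" by measurable
    have hm: "(\<lambda>\<omega>. H (obs_rv ts i \<omega>)) \<in> borel_measurable ?P" unfolding H_def using i by measurable
    have tb: "AE \<omega> in ?P. \<bar>theta_rv ts i \<omega>\<bar> \<le> m" by (rule AE_abs_theta_le) (fact ts i)+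
    have ob: "\<bar>oracle_mean n ts i x\<bar> \<le> m" for x by (rule abs_oracle_mean_le) (fact ts i)+
    have hb: "\<bar>H y\<bar> \<le> B" for y
      using abs_multiscale_rule_le[of n "m + 1" "r + 1" ts y] n m r by (simp add: H_def B_def)
    have pm: "\<bar>u * w\<bar> \<le> B * c" if "\<bar>u\<bar> \<le> B" "\<bar>w\<bar> \<le> c" for u w c :: real
      unfolding abs_mult using that B0 by (intro mult_mono) auto
    have i1: "integrable ?P (\<lambda>\<omega>. ?F \<omega> * theta_rv ts i \<omega>)"
      by (rule bounded_int[of _ "B * m"])
         (use tb f_bound[OF i] pm in \<open>auto elim!: eventually_mono intro!: borel_measurable_times fm\<close>)
    have i2: "integrable ?P (\<lambda>\<omega>. ?F \<omega> * oracle_mean n ts i (obs_vec n ts \<omega>))"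
      by (rule bounded_int[of _ "B * m"]) (use ob f_bound[OF i] pm in \<open>auto intro!: borel_measurable_times fm\<close>)
    have i3: "integrable ?P (\<lambda>\<omega>. ?F \<omega> * H (obs_rv ts i \<omega>))"
      by (rule bounded_int[of _ "B * B"]) (use hb f_bound[OF i] pm in \<open>auto intro!: borel_measurable_times fm hm\<close>)
    have "(\<lambda>\<omega>. (theta_rv ts i \<omega> - H (obs_rv ts i \<omega>)) * ?F \<omega>) = (\<lambda>\<omega>. ?F \<omega> * theta_rv ts i \<omega> - ?F \<omega> * H (obs_rv ts i \<omega>))"
      by (simp add: fun_eq_iff algebra_simps)
    thus "integrable ?P (\<lambda>\<omega>. (theta_rv ts i \<omega> - H (obs_rv ts i \<omega>)) * ?F \<omega>)" using i1 i3 by simp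
    have "(\<integral>\<omega>. (?F \<omega>)\<^sup>2 \<partial>?P) = (\<integral>\<omega>. ?F \<omega> * oracle_mean n ts i (obs_vec n ts \<omega>) - ?F \<omega> * H (obs_rv ts i \<omega>) \<partial>?P)"
      by (intro Bochner_Integration.integral_cong refl)
         (simp add: f_def rule_gap_def H_def obs_vec_def i power2_eq_square algebra_simps)
    also have "\<dots> = (\<integral>\<omega>. ?F \<omega> * oracle_mean n ts i (obs_vec n ts \<omega>) \<partial>?P) - (\<integral>\<omega>. ?F \<omega> * H (obs_rv ts i \<omega>) \<partial>?P)"
      using i2 i3 by simp
    also have "(\<integral>\<omega>. ?F \<omega> * oracle_mean n ts i (obs_vec n ts \<omega>) \<partial>?P) = (\<integral>\<omega>. ?F \<omega> * theta_rv ts i \<omega> \<partial>?P)"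
      by (rule integral_oracle_mean_times[where b = m and B = B]) (use ts i f_bound[OF i] f_meas[OF i] in auto)
    also have "(\<integral>\<omega>. ?F \<omega> * theta_rv ts i \<omega> \<partial>?P) - (\<integral>\<omega>. ?F \<omega> * H (obs_rv ts i \<omega>) \<partial>?P)
       = (\<integral>\<omega>. ?F \<omega> * theta_rv ts i \<omega> - ?F \<omega> * H (obs_rv ts i \<omega>) \<partial>?P)"
      using i1 i3 by simp
    also have "\<dots> = (\<integral>\<omega>. (theta_rv ts i \<omega> - H (obs_rv ts i \<omega>)) * ?F \<omega> \<partial>?P)"
      by (intro Bochner_Integration.integral_cong refl) (simp add: algebra_simps)
    finally show "(\<integral>\<omega>. (?F \<omega>)\<^sup>2 \<partial>?P) = (\<integral>\<omega>. (theta_rv ts i \<omega> - H (obs_rv ts i \<omega>)) * ?F \<omega> \<partial>?P)" .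
  qed

  define dev where "dev g \<omega> = (\<Sum>i<n. (g (fst \<omega> i) (obs_rv ts i \<omega>) - post_mean n ts g (obs_rv ts i \<omega>)) * f i (obs_vec n ts \<omega>))"
    for g :: "nat \<Rightarrow> real \<Rightarrow> real" and \<omega>
  define res where "res \<omega> = (\<Sum>i<n. residual n ts (m + 1) (r + 1) (fst \<omega> i) (obs_rv ts i \<omega>) * f i (obs_vec n ts \<omega>))" for \<omega>
  define tot where "tot \<omega> = (\<Sum>i<n. (theta_rv ts i \<omega> - H (obs_rv ts i \<omega>)) * f i (obs_vec n ts \<omega>))" for \<omega>
  let ?c0 = "coarse ts (m + 1) (r + 1)"
  have tot_int: "integrable ?P tot" unfolding tot_def using Hint by (intro Bochner_Integration.integrable_sum) auto
  have D_tot: "D = (\<integral>\<omega>. tot \<omega> \<partial>?P)"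
    unfolding D_eq tot_def using Hint Hgap by (subst Bochner_Integration.integral_sum) auto
  have split: "tot \<omega> = dev ?c0 \<omega> + (\<Sum>j<n. dev (level ts j) \<omega>) + res \<omega>" for \<omega>
  proof -
    let ?F = "\<lambda>i. f i (obs_vec n ts \<omega>)"
    have "(\<Sum>j<n. dev (level ts j) \<omega>)
      = (\<Sum>i<n. (\<Sum>j<n. level ts j (fst \<omega> i) (obs_rv ts i \<omega>) - post_mean n ts (level ts j) (obs_rv ts i \<omega>)) * ?F i)"
      unfolding dev_def sum_distrib_right by (rule sum.swap)
    hence "dev ?c0 \<omega> + (\<Sum>j<n. dev (level ts j) \<omega>) + res \<omega>
      = (\<Sum>i<n. (?c0 (fst \<omega> i) (obs_rv ts i \<omega>) - post_mean n ts ?c0 (obs_rv ts i \<omega>)) * ?F i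
          + (\<Sum>j<n. level ts j (fst \<omega> i) (obs_rv ts i \<omega>) - post_mean n ts (level ts j) (obs_rv ts i \<omega>)) * ?F i
          + residual n ts (m + 1) (r + 1) (fst \<omega> i) (obs_rv ts i \<omega>) * ?F i)"
      by (simp only: dev_def res_def sum.distrib)
    also have "\<dots> = tot \<omega>"
      unfolding tot_def
      by (rule sum.cong[OF refl])
         (simp add: H_def multiscale_rule_def residual_def theta_rv_def sum_subtractf algebra_simps)
    finally show ?thesis by (rule sym)
  qed

  have dev0_int: "integrable ?P (dev ?c0)"
    and dev0: "(\<integral>\<omega>. dev ?c0 \<omega> \<partial>?P) \<le> 1 / 8 * D + (2 * (r + 1))\<^sup>2 / (8 * (1 / 8))
       * (3 * real (card ((\<lambda>k. \<lfloor>2 ^ 0 * ts k\<rfloor>) ` {..<n})) * (1 + ln (real n)) + 2)"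
  proof -
    have g1: "\<bar>ts k - ts l\<bar> \<le> 1" if "\<lfloor>2 ^ 0 * ts k\<rfloor> = \<lfloor>2 ^ 0 * ts l\<rfloor>" for k l by (rule grid_cell_diam[OF that])
    have g2: "?c0 k x = ?c0 l x" if "\<lfloor>2 ^ 0 * ts k\<rfloor> = \<lfloor>2 ^ 0 * ts l\<rfloor>" for k l x
      using that by (simp add: coarse_def grid_def)
    have g3: "clamp_real (m + 1) x - (r + 1) \<le> ?c0 k x \<and> ?c0 k x \<le> clamp_real (m + 1) x - (r + 1) + 2 * (r + 1)" for k x
      unfolding coarse_def by (rule window_range) (use r in auto)
    have R: "0 < 2 * (r + 1)" using r by simp
    have a: "0 < (1 / 8 :: real)" by simp
    note X = label_deviation_bound[where g = ?c0 and c = "\<lambda>k. \<lfloor>2 ^ 0 * ts k\<rfloor>" and lo = "\<lambda>x. clamp_real (m + 1) x - (r + 1)",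
        OF n g1 measurable_coarse g2 g3 f_meas f_bound a R]
    show "integrable ?P (dev ?c0)" using X(1) unfolding dev_def[abs_def] by simp
    show "(\<integral>\<omega>. dev ?c0 \<omega> \<partial>?P) \<le> 1 / 8 * D + (2 * (r + 1))\<^sup>2 / (8 * (1 / 8))
       * (3 * real (card ((\<lambda>k. \<lfloor>2 ^ 0 * ts k\<rfloor>) ` {..<n})) * (1 + ln (real n)) + 2)"
      using X(2) unfolding dev_def D_def by simp
  qed
  have devj_int: "integrable ?P (dev (level ts j))"
    and devj: "(\<integral>\<omega>. dev (level ts j) \<omega> \<partial>?P) \<le> (3 / 4) ^ j / 32 * D + (1 / 2 ^ j)\<^sup>2 / (8 * ((3 / 4) ^ j / 32))
       * (3 * real (card ((\<lambda>k. \<lfloor>2 ^ Suc j * ts k\<rfloor>) ` {..<n})) * (1 + ln (real n)) + 2)" for j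
  proof -
    have g1: "\<bar>ts k - ts l\<bar> \<le> 1" if "\<lfloor>2 ^ Suc j * ts k\<rfloor> = \<lfloor>2 ^ Suc j * ts l\<rfloor>" for k l by (rule grid_cell_diam[OF that])
    have g2: "level ts j k x = level ts j l x" if "\<lfloor>2 ^ Suc j * ts k\<rfloor> = \<lfloor>2 ^ Suc j * ts l\<rfloor>" for k l x
    proof -
      have "grid (Suc j) (ts k) = grid (Suc j) (ts l)" using that by (simp only: grid_def)
      thus ?thesis using grid_cong_Suc[OF that] by (simp only: level_def)
    qed
    have R: "0 < 1 / (2 ^ j :: real)" by simp
    have a: "0 < (3 / 4) ^ j / (32 :: real)" by simp
    note X = label_deviation_bound[where g = "level ts j" and c = "\<lambda>k. \<lfloor>2 ^ Suc j * ts k\<rfloor>" and lo = "\<lambda>x. 0",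
        OF n g1 measurable_level g2 level_range f_meas f_bound a R]
    show "integrable ?P (dev (level ts j))" using X(1) unfolding dev_def[abs_def] by simp
    show "(\<integral>\<omega>. dev (level ts j) \<omega> \<partial>?P) \<le> (3 / 4) ^ j / 32 * D + (1 / 2 ^ j)\<^sup>2 / (8 * ((3 / 4) ^ j / 32))
       * (3 * real (card ((\<lambda>k. \<lfloor>2 ^ Suc j * ts k\<rfloor>) ` {..<n})) * (1 + ln (real n)) + 2)"
      using X(2) unfolding dev_def D_def by simp
  qed

  have dev0_le: "(\<integral>\<omega>. dev ?c0 \<omega> \<partial>?P) \<le> 1 / 8 * D + 224 * (m * L\<^sup>2)"
  proof -
    let ?K = "real (card ((\<lambda>k. \<lfloor>2 ^ 0 * ts k\<rfloor>) ` {..<n}))"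
    have "?K \<le> 4 * m" using card_grid_cells_le[OF m, of n ts 0] ts by simp
    hence "?K * L \<le> 4 * m * L" using L by (intro mult_right_mono) auto
    hence 1: "3 * ?K * L + 2 \<le> 14 * (m * L)" using mL by linarith
    have "(r + 1)\<^sup>2 \<le> 2 * r\<^sup>2 + 2" using square_add_le[of r 1] by simp
    also have "\<dots> \<le> 4 * L" by (simp add: r2 L_def)
    finally have "(2 * (r + 1))\<^sup>2 / (8 * (1 / 8)) \<le> 16 * L" unfolding power_mult_distrib by simp
    hence "(2 * (r + 1))\<^sup>2 / (8 * (1 / 8)) * (3 * ?K * L + 2) \<le> 16 * L * (14 * (m * L))"
      using 1 L by (intro mult_mono) auto
    also have "\<dots> = 224 * (m * L\<^sup>2)" by (simp add: power2_eq_square)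
    finally show ?thesis using dev0 unfolding L_def[symmetric] by linarith
  qed
  have devj_le: "(\<integral>\<omega>. dev (level ts j) \<omega> \<partial>?P) \<le> D / 32 * (3 / 4) ^ j + 104 * (m * L) * (2 / 3) ^ j" for j
  proof -
    let ?K = "real (card ((\<lambda>k. \<lfloor>2 ^ Suc j * ts k\<rfloor>) ` {..<n}))"
    have p: "(1::real) \<le> 2 ^ j" by simp
    have "?K \<le> 8 * 2 ^ j * m" using card_grid_cells_le[OF m, of n ts "Suc j"] ts by simp
    hence "?K * L \<le> 8 * 2 ^ j * m * L" using L by (intro mult_right_mono) auto
    moreover have "1 * 1 \<le> 2 ^ j * (m * L)" using mL p by (intro mult_mono) auto
    ultimately have 1: "3 * ?K * L + 2 \<le> 26 * (2 ^ j * (m * L))" by linarith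
    have "(1 / 2 ^ j)\<^sup>2 / (8 * ((3 / 4) ^ j / 32)) * (3 * ?K * L + 2)
      \<le> (1 / 2 ^ j)\<^sup>2 / (8 * ((3 / 4) ^ j / 32)) * (26 * (2 ^ j * (m * L)))"
      using 1 by (intro mult_left_mono) auto
    also have "\<dots> = 104 * (m * L) * (1 / (2 ^ j * (3 / 4) ^ j))"
      by (simp add: power2_eq_square)
    also have "(2::real) ^ j * (3 / 4) ^ j = (3 / 2) ^ j" by (simp flip: power_mult_distrib)
    also have "1 / (3 / 2 :: real) ^ j = (2 / 3) ^ j" by (simp add: power_divide)
    finally show ?thesis using devj[of j] unfolding L_def[symmetric] by (simp add: mult.commute)
  qed
  have devs_le: "(\<Sum>j<n. \<integral>\<omega>. dev (level ts j) \<omega> \<partial>?P) \<le> 1 / 8 * D + 312 * (m * L\<^sup>2)"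
  proof -
    have D0: "0 \<le> D" unfolding D_def by (intro integral_nonneg_AE AE_I2 sum_nonneg) simp
    have "(\<Sum>j<n. \<integral>\<omega>. dev (level ts j) \<omega> \<partial>?P) \<le> (\<Sum>j<n. D / 32 * (3 / 4) ^ j + 104 * (m * L) * (2 / 3) ^ j)"
      by (rule sum_mono) (rule devj_le)
    also have "\<dots> = D / 32 * (\<Sum>j<n. (3 / 4) ^ j) + 104 * (m * L) * (\<Sum>j<n. (2 / 3) ^ j)"
      by (simp only: sum.distrib sum_distrib_left)
    also have "\<dots> \<le> D / 32 * 4 + 104 * (m * L) * 3"
      using sum_power_le[of "3 / 4" n] sum_power_le[of "2 / 3" n] D0 mL
      by (intro add_mono mult_left_mono) auto
    finally show ?thesis using LL by linarith
  qed

  have res_int: "integrable ?P res"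
  proof -
    have "res = (\<lambda>\<omega>. tot \<omega> - dev ?c0 \<omega> - (\<Sum>j<n. dev (level ts j) \<omega>))" by (simp add: fun_eq_iff split)
    thus ?thesis using tot_int dev0_int devj_int by simp
  qed
  have res_le: "(\<integral>\<omega>. res \<omega> \<partial>?P) \<le> 1 / 4 * D + 10 * (m * L\<^sup>2)"
  proof -
    let ?W = "\<lambda>i \<omega>. (max 0 (\<bar>snd \<omega> i\<bar> - r))\<^sup>2 :: real"
    have Wint: "integrable ?P (?W i)" "(\<integral>\<omega>. ?W i \<omega> \<partial>?P) \<le> 4 / real n" if i: "i < n" for i
    proof -
      show "integrable ?P (?W i)" by (rule perm_gauss_noise_excess(1)[OF i r])
      have "4 / r\<^sup>2 * exp (- r\<^sup>2 / 2) = 2 / ln (real n) * (1 / real n)"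
        using n by (simp add: r2 exp_minus inverse_eq_divide)
      also have "\<dots> \<le> 4 * (1 / real n)" using ln by (intro mult_right_mono) (auto simp: divide_le_eq)
      finally show "(\<integral>\<omega>. ?W i \<omega> \<partial>?P) \<le> 4 / real n" using perm_gauss_noise_excess(2)[OF i r] by simp
    qed
    have "AE \<omega> in ?P. res \<omega> \<le> (\<Sum>i<n. 2 / 4 ^ n + 2 * ?W i \<omega> + (f i (obs_vec n ts \<omega>))\<^sup>2 / 4)"
      using AE_perm_gauss_permutes
    proof eventually_elim
      case (elim \<omega>)
      show ?case unfolding res_def
      proof (rule sum_mono)
        fix i assume i: "i \<in> {..<n}"
        let ?e = "residual n ts (m + 1) (r + 1) (fst \<omega> i) (obs_rv ts i \<omega>)" and ?y = "f i (obs_vec n ts \<omega>)"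
        have k: "fst \<omega> i < n" using permutes_in_image[OF elim, of i] i by simp
        have "?e\<^sup>2 \<le> 2 / 4 ^ n + 2 * ?W i \<omega>"
          unfolding obs_rv_def using residual_square_le[of ts "fst \<omega> i" m r n "snd \<omega> i"] ts[OF k] r by simp
        moreover have "?e * ?y \<le> ?e\<^sup>2 + ?y\<^sup>2 / 4"
          using zero_le_power2[of "?e - ?y / 2"] by (simp add: power2_eq_square algebra_simps)
        ultimately show "?e * ?y \<le> 2 / 4 ^ n + 2 * ?W i \<omega> + ?y\<^sup>2 / 4" by linarith
      qed
    qed
    hence "(\<integral>\<omega>. res \<omega> \<partial>?P) \<le> (\<integral>\<omega>. (\<Sum>i<n. 2 / 4 ^ n + 2 * ?W i \<omega> + (f i (obs_vec n ts \<omega>))\<^sup>2 / 4) \<partial>?P)"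
      using Wint(1) fint by (intro integral_mono_AE res_int) auto
    also have "\<dots> = (\<Sum>i<n. 2 / 4 ^ n + 2 * (\<integral>\<omega>. ?W i \<omega> \<partial>?P) + (\<integral>\<omega>. (f i (obs_vec n ts \<omega>))\<^sup>2 \<partial>?P) / 4)"
      using Wint(1) fint by (subst Bochner_Integration.integral_sum) (auto simp: prob_space)
    also have "\<dots> \<le> (\<Sum>i<n. 2 / 4 ^ n + 2 * (4 / real n) + (\<integral>\<omega>. (f i (obs_vec n ts \<omega>))\<^sup>2 \<partial>?P) / 4)"
      using Wint(2) by (intro sum_mono add_mono mult_left_mono) auto
    also have "\<dots> = real n * (2 / 4 ^ n) + 8 + D / 4"
      using n by (simp add: sum.distrib D_eq sum_divide_distrib distrib_left)
    also have "real n * (2 / 4 ^ n) \<le> 2"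
    proof -
      have "real n \<le> 4 ^ n"
        using less_exp[of n] power_mono[of "2::real" 4 n] of_nat_less_iff[of n "2 ^ n", where 'a = real] by simp
      thus ?thesis by (simp add: divide_le_eq)
    qed
    finally show ?thesis using mL LL by linarith
  qed

  have "D = (\<integral>\<omega>. dev ?c0 \<omega> \<partial>?P) + (\<Sum>j<n. \<integral>\<omega>. dev (level ts j) \<omega> \<partial>?P) + (\<integral>\<omega>. res \<omega> \<partial>?P)"
    unfolding D_tot split using dev0_int devj_int res_int by simp
  hence "D \<le> 1092 * (m * L\<^sup>2)" using dev0_le devs_le res_le by linarith
  thus ?thesis unfolding D_eq f_def L_def by (simp add: mult.assoc)
qed

lemma risk_gap_le_1:
  fixes ts :: "nat \<Rightarrow> real"
  assumes ts: "\<And>k. k < n \<Longrightarrow> \<bar>ts k\<bar> \<le> m" and i: "i < n"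
  shows "(\<integral>\<omega>. (sep_est n ts i \<omega> - pi_est n ts i \<omega>)\<^sup>2 \<partial>perm_gauss_space n) \<le> 1"
proof -
  let ?P = "perm_gauss_space n"
  have "(\<integral>\<omega>. (sep_est n ts i \<omega> - pi_est n ts i \<omega>)\<^sup>2 \<partial>?P) \<le> (\<integral>\<omega>. (theta_rv ts i \<omega> - obs_rv ts i \<omega>)\<^sup>2 \<partial>?P)"
    by (rule separable_gap_le(3)[where h = "\<lambda>x. x" and b = m])
       (use ts i obs_rv_square_integrable[of n ts m i] in auto)
  also have "\<dots> = (\<integral>\<omega>. (snd \<omega> i)\<^sup>2 \<partial>?P)" by (simp add: theta_rv_def obs_rv_def)
  also have "\<dots> = 1" by (rule perm_gauss_noise_square(2)[OF i])
  finally show ?thesis .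
qed

theorem theorem6:
  shows "\<exists>C::real. \<forall>(n::nat) (\<mu>::real) (ts::nat \<Rightarrow> real).
           \<mu> \<ge> 1 \<longrightarrow> (\<forall>i<n. \<bar>ts i\<bar> \<le> \<mu>) \<longrightarrow>
           (\<integral>\<^sup>+ \<omega>. ennreal (\<Sum>i<n. (sep_est n ts i \<omega> - pi_est n ts i \<omega>)\<^sup>2) \<partial>perm_gauss_space n)
             \<le> ennreal (min (C * \<mu> * (ln (real n))\<^sup>2) (real n))"
proof (intro exI allI impI)
  fix n :: nat and \<mu> :: real and ts :: "nat \<Rightarrow> real"
  assume \<mu>: "1 \<le> \<mu>" and "\<forall>i<n. \<bar>ts i\<bar> \<le> \<mu>"
  hence ts: "\<bar>ts k\<bar> \<le> \<mu>" if "k < n" for k using that by blast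
  let ?P = "perm_gauss_space n"
  interpret prob_space ?P by (rule prob_space_perm_gauss)
  let ?d = "\<lambda>i \<omega>. (sep_est n ts i \<omega> - pi_est n ts i \<omega>)\<^sup>2"
  have int: "integrable ?P (?d i)" if "i < n" for i
    by (rule separable_gap_le(1)[where h = "\<lambda>_. 0" and b = \<mu>]) (use ts that in auto)
  have "(\<integral>\<^sup>+ \<omega>. ennreal (\<Sum>i<n. ?d i \<omega>) \<partial>?P) = ennreal (\<integral>\<omega>. (\<Sum>i<n. ?d i \<omega>) \<partial>?P)"
    by (rule nn_integral_eq_integral) (use int in \<open>auto intro!: sum_nonneg\<close>)
  also have "(\<integral>\<omega>. (\<Sum>i<n. ?d i \<omega>) \<partial>?P) = (\<Sum>i<n. \<integral>\<omega>. ?d i \<omega> \<partial>?P)"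
    by (rule Bochner_Integration.integral_sum) (use int in auto)
  also have "\<dots> \<le> min (9828 * \<mu> * (ln (real n))\<^sup>2) (real n)"
  proof (rule min.boundedI)
    have "(\<Sum>i<n. \<integral>\<omega>. ?d i \<omega> \<partial>?P) \<le> (\<Sum>i<n. 1)"
      by (intro sum_mono risk_gap_le_1[where m = \<mu>]) (use ts in auto)
    thus "(\<Sum>i<n. \<integral>\<omega>. ?d i \<omega> \<partial>?P) \<le> real n" by simp
    consider "n = 0" | "n = 1" | "2 \<le> n" by linarith
    thus "(\<Sum>i<n. \<integral>\<omega>. ?d i \<omega> \<partial>?P) \<le> 9828 * \<mu> * (ln (real n))\<^sup>2"
    proof cases
      case 2
      have "(\<integral>\<omega>. ?d 0 \<omega> \<partial>?P) \<le> (\<integral>\<omega>. (theta_rv ts 0 \<omega> - ts 0)\<^sup>2 \<partial>?P)"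
        by (rule separable_gap_le(3)[where h = "\<lambda>_. ts 0" and b = \<mu>]) (rule ts integrable_const | assumption | simp add: 2)+
      also have "\<dots> = (\<integral>\<omega>. 0 \<partial>?P)"
      proof (rule integral_cong_AE)
        show "AE \<omega> in ?P. (theta_rv ts 0 \<omega> - ts 0)\<^sup>2 = 0"
          using AE_perm_gauss_permutes
        proof eventually_elim
          case (elim \<omega>)
          thus ?case using permutes_in_image[OF elim, of 0] 2 by (simp add: theta_rv_def)
        qed
      qed auto
      finally show ?thesis using 2 by simp
    next
      case 3
      let ?r = "sqrt (2 * ln (real n))"
      let ?h = "multiscale_rule n ts (\<mu> + 1) (?r + 1)"
      have ln: "1 / 2 \<le> ln (real n)" by (rule ln_ge_half[OF 3])
      have hb: "\<bar>?h y\<bar> \<le> \<mu> + 1 + (?r + 1) + real n" for y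
        by (rule abs_multiscale_rule_le) (use 3 \<mu> ln in auto)
      have "(\<Sum>i<n. \<integral>\<omega>. ?d i \<omega> \<partial>?P) \<le> (\<Sum>i<n. \<integral>\<omega>. (rule_gap n ts (\<mu> + 1) (?r + 1) i (obs_vec n ts \<omega>))\<^sup>2 \<partial>?P)"
      proof (rule sum_mono)
        fix i assume "i \<in> {..<n}"
        hence i: "i < n" by simp
        have [measurable]: "obs_rv ts i \<in> borel_measurable ?P" by (rule measurable_obs_rv[OF i])
        have "integrable ?P (\<lambda>\<omega>. (?h (obs_rv ts i \<omega>))\<^sup>2)"
        proof (rule integrable_const_bound)
          have "(?h y)\<^sup>2 \<le> (\<mu> + 1 + (?r + 1) + real n)\<^sup>2" for y using hb[of y] by (metis abs_ge_zero power2_abs power_mono)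
          thus "AE \<omega> in ?P. norm ((?h (obs_rv ts i \<omega>))\<^sup>2) \<le> (\<mu> + 1 + (?r + 1) + real n)\<^sup>2" by simp
        qed measurable
        from separable_gap_le(2)[where h = ?h and b = \<mu>, OF _ i _ this] ts
        show "(\<integral>\<omega>. ?d i \<omega> \<partial>?P) \<le> (\<integral>\<omega>. (rule_gap n ts (\<mu> + 1) (?r + 1) i (obs_vec n ts \<omega>))\<^sup>2 \<partial>?P)"
          by (simp add: rule_gap_def obs_vec_def i)
      qed
      also have "\<dots> \<le> 1092 * \<mu> * (1 + ln (real n))\<^sup>2"
        by (rule rule_gap_bound[OF 3 \<mu>]) (rule ts)
      also have "\<dots> \<le> 1092 * \<mu> * (3 * ln (real n))\<^sup>2"
        using \<mu> ln by (intro mult_left_mono power_mono) auto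
      finally show ?thesis by (simp add: power_mult_distrib)
    qed simp
  qed
  finally show "(\<integral>\<^sup>+ \<omega>. ennreal (\<Sum>i<n. ?d i \<omega>) \<partial>?P) \<le> ennreal (min (9828 * \<mu> * (ln (real n))\<^sup>2) (real n))"
    by (simp add: ennreal_leI)
qed

end
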